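(* Let $n\ge1$, $A\ge0$, and let $f:\mathbb{S}^n\to(0,1]$ be $A$-Lipschitz with respect to the geodesic distance. Consider the algorithm: set $L_{todo}=\mathcal{B}_0$ and $L_{final}=\emptyset$; while $L_{todo}$ is nonempty, set $L_{next}=\emptyset$ and for each ball $B_{\mathbb{S}^n}(x,r)\in L_{todo}$, if $r<f(x)$ add it to $L_{final}$, otherwise add all balls of $\mathrm{divide}(B_{\mathbb{S}^n}(x,r))$ to $L_{next}$; then set $L_{todo}=L_{next}$. Return $L_{final}$. Then the algorithm terminates, its output $L_{final}$ is a finite open cover of $\mathbb{S}^n$ by balls $B_{\mathbb{S}^n}(c_B,r_B)$ each satisfying $r_B\le f(c_B)$, and the algorithm performs fewer than $$\frac{(16(2+A))^n}{A_n\ln 2}\int_{\mathbb{S}^n}\Big(\frac{1}{f}\Big)^n\,dV$$ evaluations of $f$. Moreover $L_{final}=\mathcal{M}_k$ where $k=\min\{k\in\mathbb{Z}_{\ge0}\mid \mathcal{L}_k=\emptyset\}$.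
   Context: $\mathbb{S}^n\subset\mathbb{R}^{n+1}$ is the unit sphere with geodesic distance $d_{\mathbb{S}^n}$ and Riemannian volume measure $dV$; $B_{\mathbb{S}^n}(x,r)$ is the open geodesic ball; $A_n$ denotes the area of the $(n-1)$-dimensional unit sphere. For each integer $k\ge0$, $\mathcal{J}_k\subset\mathbb{S}^n$ is a fixed maximal set such that distinct $x,x'\in\mathcal{J}_k$ satisfy $d_{\mathbb{S}^n}(x,x')\ge2^{-k}$, and $\mathcal{B}_k=\{B_{\mathbb{S}^n}(x,2^{-k})\mid x\in\mathcal{J}_k\}$. For a ball $B$ write $c_B$ for its center and $r_B$ for its radius. For $B\in\mathcal{B}_k$, $\mathrm{divide}(B)=\{B'\in\mathcal{B}_{k+1}\mid B'\cap B\neq\emptyset\}$. Define $\mathcal{L}_0=\mathcal{B}_0$, $\mathcal{L}_{k+1}=\bigcup\{\mathrm{divide}(B)\mid B\in\mathcal{L}_k,\ r_B\ge f(c_B)\}$, and $\mathcal{M}_k=\bigcup_{i=0}^k\{B\in\mathcal{L}_i\mid r_B<f(c_B)\}$. *)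

theory Defs
  imports "HOL-Analysis.Analysis"
begin

section \<open>Geometry of the unit sphere\<close>

text \<open>
  The Riemannian distance of the unit sphere: the infimum of the lengths of the piecewise
  continuously differentiable curves on the sphere from \<open>x\<close> to \<open>y\<close>. The library predicate does not
  bound the derivative near the break points, and \<open>integral\<close> of a function that is not integrable
  is 0, so finiteness of the length has to be required explicitly.
\<close>

definition curve_length :: "(real \<Rightarrow> 'b::euclidean_space) \<Rightarrow> real" where
  "curve_length \<gamma> = integral {0..1} (\<lambda>t. norm (vector_derivative \<gamma> (at t)))"

definition sphere_curves :: "'b::euclidean_space \<Rightarrow> 'b \<Rightarrow> (real \<Rightarrow> 'b) set" where
  "sphere_curves x y =
     {\<gamma>. \<gamma> piecewise_C1_differentiable_on {0..1} \<and>
         (\<lambda>t. norm (vector_derivative \<gamma> (at t))) integrable_on {0..1} \<and>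
         path_image \<gamma> \<subseteq> sphere 0 1 \<and> pathstart \<gamma> = x \<and> pathfinish \<gamma> = y}"

definition geodesic_dist :: "'b::euclidean_space \<Rightarrow> 'b \<Rightarrow> real" where
  "geodesic_dist x y = (INF \<gamma>\<in>sphere_curves x y. curve_length \<gamma>)"

text \<open>
  The Riemannian volume measure of the unit sphere of \<open>'b\<close>, as the surface measure of polar
  coordinates: the volume of \<open>E\<close> is \<open>DIM('b)\<close> times the Lebesgue measure of the cone
  \<open>{t x | 0 < t < 1, x \<in> E}\<close> (note that \<open>sgn x = x / norm x\<close>). If \<open>'b\<close> is one-dimensional, this is the
  counting measure on the two points of the sphere.
\<close>

definition sphere_measure :: "'b::euclidean_space measure" where
  "sphere_measure =
     scale_measure (of_nat DIM('b))
       (distr (restrict_space lborel (ball 0 1 - {0})) (restrict_space borel (sphere 0 1)) sgn)"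

lemma emeasure_sphere_measure:
  fixes E :: "'b::euclidean_space set"
  assumes E: "E \<in> sets borel" "E \<subseteq> sphere 0 1"
  shows "emeasure sphere_measure E =
           of_nat DIM('b) * emeasure lborel {x. x \<noteq> 0 \<and> norm x < 1 \<and> sgn x \<in> E}"
proof -
  let ?D = "ball 0 1 - {0} :: 'b set" and ?S = "sphere 0 1 :: 'b set"
  have sgn_meas: "sgn \<in> restrict_space lborel ?D \<rightarrow>\<^sub>M restrict_space borel ?S"
  proof (rule measurable_restrict_space2)
    show "sgn \<in> space (restrict_space lborel ?D) \<rightarrow> ?S"
      by (auto simp: space_restrict_space norm_sgn)
    have "(\<lambda>x::'b. x /\<^sub>R norm x) \<in> borel_measurable borel" by measurable
    then have "(sgn :: 'b \<Rightarrow> 'b) \<in> borel_measurable lborel"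
      by (simp add: sgn_div_norm[abs_def])
    then show "sgn \<in> borel_measurable (restrict_space lborel ?D)"
      by (rule measurable_restrict_space1)
  qed
  have E': "E \<in> sets (restrict_space borel ?S)"
    using E by (auto simp: sets_restrict_space_iff)
  have "sgn -` E \<inter> space (restrict_space lborel ?D) = {x. x \<noteq> 0 \<and> norm x < 1 \<and> sgn x \<in> E}"
    by (auto simp: space_restrict_space)
  then show ?thesis
    using E' by (simp add: sphere_measure_def emeasure_distr[OF sgn_meas E'] emeasure_restrict_space)
      (subst emeasure_restrict_space, auto)
qed

lemma nn_integral_abs_power:
  fixes a :: real and e1 e2 :: ennreal
  assumes "a > 0"
  shows "(\<integral>\<^sup>+s. ennreal (\<bar>s\<bar> ^ N) * (if 0 < s \<and> s < a then e1 else if s < 0 \<and> - s < a then e2 else 0) \<partial>lborel)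
           = (e1 + e2) * ennreal (a ^ Suc N / Suc N)"
proof -
  have *: "(\<integral>\<^sup>+s. ennreal (s ^ N) * indicator {0..a} s \<partial>lborel) = ennreal (a ^ Suc N / Suc N)"
  proof -
    have "((\<lambda>s. s ^ Suc N / Suc N) has_real_derivative s ^ N) (at s)" for s :: real
      by (rule derivative_eq_intros refl | simp)+
    then show ?thesis
      using assms by (subst nn_integral_FTC_Icc[where F = "\<lambda>s. s ^ Suc N / Suc N"]) auto
  qed
  have **: "(\<integral>\<^sup>+s. ennreal (\<bar>s\<bar> ^ N) * indicator {-a..0} s \<partial>lborel) = ennreal (a ^ Suc N / Suc N)"
    unfolding *[symmetric]
    by (subst nn_integral_real_affine[where c = "-1" and t = 0])
      (auto intro!: nn_integral_cong simp: indicator_def)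
  have "(\<integral>\<^sup>+s. ennreal (\<bar>s\<bar> ^ N) * (if 0 < s \<and> s < a then e1 else if s < 0 \<and> - s < a then e2 else 0) \<partial>lborel)
      = (\<integral>\<^sup>+s. e1 * (ennreal (s ^ N) * indicator {0..a} s) + e2 * (ennreal (\<bar>s\<bar> ^ N) * indicator {-a..0} s) \<partial>lborel)"
  proof (rule nn_integral_cong_AE)
    have "AE s in lborel. s \<noteq> (0::real) \<and> s \<noteq> a \<and> s \<noteq> - a"
      using AE_lborel_singleton[of "0::real"] AE_lborel_singleton[of a] AE_lborel_singleton[of "-a"]
      by eventually_elim auto
    then show "AE s in lborel. ennreal (\<bar>s\<bar> ^ N) * (if 0 < s \<and> s < a then e1 else if s < 0 \<and> - s < a then e2 else 0)
       = e1 * (ennreal (s ^ N) * indicator {0..a} s) + e2 * (ennreal (\<bar>s\<bar> ^ N) * indicator {-a..0} s)"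
      by eventually_elim (auto simp: indicator_def mult.commute)
  qed
  also have "\<dots> = (e1 + e2) * ennreal (a ^ Suc N / Suc N)"
    by (subst nn_integral_add, measurable, (subst nn_integral_cmult, measurable)+)
      (simp only: * ** distrib_right)
  finally show ?thesis .
qed

text \<open>
  This is the Riemannian volume: the central projections \<open>w \<mapsto> (w, 1) / h\<close> and \<open>w \<mapsto> - (w, 1) / h\<close>,
  where \<open>h = sqrt (1 + (norm w)^2)\<close>, parametrize the two open hemispheres, and their metric tensor
  \<open>I / h^2 - w w^T / h^4\<close> has determinant \<open>1 / h^(2 * (DIM('a) + 1))\<close>, whose square root is the
  density in the following formula.
\<close>

lemma emeasure_sphere_measure_charts:
  fixes E :: "('a::euclidean_space \<times> real) set"
  assumes E: "E \<in> sets borel" "E \<subseteq> sphere 0 1"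
  shows "emeasure sphere_measure E =
    (\<integral>\<^sup>+w. (indicator E (sgn (w, 1)) + indicator E (- sgn (w, 1))) *
           ennreal (1 / sqrt (1 + (norm w)\<^sup>2) ^ (DIM('a) + 1)) \<partial>lborel)"
proof -
  let ?N = "DIM('a)"
  let ?C = "{x :: 'a \<times> real. x \<noteq> 0 \<and> norm x < 1 \<and> sgn x \<in> E}"
  let ?h = "\<lambda>w::'a. sqrt (1 + (norm w)\<^sup>2)"
  let ?G = "\<lambda>(w::'a) s::real. ennreal (\<bar>s\<bar> ^ ?N) * indicator ?C (s *\<^sub>R w, s)"
  have sgn_meas [measurable]: "(sgn :: 'a \<times> real \<Rightarrow> _) \<in> borel_measurable borel"
  proof -
    have "(\<lambda>x::'a \<times> real. x /\<^sub>R norm x) \<in> borel_measurable borel" by measurable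
    then show ?thesis by (simp add: sgn_div_norm[abs_def])
  qed
  have [measurable]: "E \<in> sets borel" by fact
  have C [measurable]: "?C \<in> sets borel" by measurable
  have h_pos: "?h w > 0" for w by (simp add: add_pos_nonneg)
  have ind: "indicator ?C (s *\<^sub>R w, s) = (if 0 < s \<and> s < 1 / ?h w then indicator E (sgn (w, 1))
      else if s < 0 \<and> - s < 1 / ?h w then indicator E (- sgn (w, 1)) else (0::ennreal))"
    if "s \<noteq> 0" for s :: real and w :: 'a
  proof -
    have eq: "(s *\<^sub>R w, s) = s *\<^sub>R (w, 1)" by simp
    have nw: "norm (w, 1::real) = ?h w" by (simp add: norm_Pair add.commute)
    have "sgn (s *\<^sub>R w, s) = sgn s *\<^sub>R sgn (w, 1::real)"
      unfolding eq sgn_scaleR ..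
    moreover have "norm (s *\<^sub>R w, s) = \<bar>s\<bar> * ?h w"
      unfolding eq norm_scaleR nw ..
    moreover have "\<bar>s\<bar> * ?h w < 1 \<longleftrightarrow> \<bar>s\<bar> < 1 / ?h w"
      using h_pos[of w] by (simp add: field_simps)
    ultimately show ?thesis
      using that by (auto simp: indicator_def zero_prod_def)
  qed
  have scale: "(\<integral>\<^sup>+y. indicator ?C (y, s) \<partial>lborel) = (\<integral>\<^sup>+w. ?G w s \<partial>lborel)" if "s \<noteq> 0" for s
    using that
    by (subst lborel_affine[where c = s and t = 0])
      (auto simp: nn_integral_density nn_integral_distr)
  have "emeasure lborel ?C = (\<integral>\<^sup>+x. indicator ?C x \<partial>(lborel \<Otimes>\<^sub>M lborel))"
    by (simp add: lborel_prod)
  also have "\<dots> = (\<integral>\<^sup>+s. \<integral>\<^sup>+y. indicator ?C (y, s) \<partial>lborel \<partial>lborel)"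
    by (subst lborel_pair.nn_integral_snd) (auto simp: lborel_prod)
  also have "\<dots> = (\<integral>\<^sup>+s. \<integral>\<^sup>+w. ?G w s \<partial>lborel \<partial>lborel)"
    by (rule nn_integral_cong_AE, use AE_lborel_singleton[of "0::real"] in eventually_elim)
      (simp add: scale)
  also have "\<dots> = (\<integral>\<^sup>+w. \<integral>\<^sup>+s. ?G w s \<partial>lborel \<partial>lborel)"
    by (rule lborel_pair.Fubini') (simp add: split_beta', measurable)
  also have "\<dots> = (\<integral>\<^sup>+w. (indicator E (sgn (w, 1)) + indicator E (- sgn (w, 1))) *
           ennreal ((1 / ?h w) ^ Suc ?N / Suc ?N) \<partial>lborel)"
  proof (rule nn_integral_cong)
    fix w :: 'a
    have "(\<integral>\<^sup>+s. ?G w s \<partial>lborel) = (\<integral>\<^sup>+s. ennreal (\<bar>s\<bar> ^ ?N) *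
        (if 0 < s \<and> s < 1 / ?h w then indicator E (sgn (w, 1))
         else if s < 0 \<and> - s < 1 / ?h w then indicator E (- sgn (w, 1)) else 0) \<partial>lborel)"
      by (rule nn_integral_cong_AE, use AE_lborel_singleton[of "0::real"] in eventually_elim)
        (simp only: ind not_False_eq_True)
    then show "(\<integral>\<^sup>+s. ?G w s \<partial>lborel) = (indicator E (sgn (w, 1)) + indicator E (- sgn (w, 1))) *
           ennreal ((1 / ?h w) ^ Suc ?N / Suc ?N)"
      using nn_integral_abs_power[of "1 / ?h w"] h_pos[of w] by simp
  qed
  finally have main: "emeasure lborel ?C = \<dots>" .
  have "emeasure sphere_measure E = of_nat (Suc ?N) * emeasure lborel ?C"
    by (subst emeasure_sphere_measure[OF E]) simp
  also have "\<dots> = (\<integral>\<^sup>+w. of_nat (Suc ?N) * ((indicator E (sgn (w, 1)) + indicator E (- sgn (w, 1))) *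
           ennreal ((1 / ?h w) ^ Suc ?N / Suc ?N)) \<partial>lborel)"
    unfolding main by (rule nn_integral_cmult[symmetric]) measurable
  also have "\<dots> = (\<integral>\<^sup>+w. (indicator E (sgn (w, 1)) + indicator E (- sgn (w, 1))) *
           ennreal (1 / ?h w ^ (?N + 1)) \<partial>lborel)"
  proof (rule nn_integral_cong)
    fix w :: 'a
    have "real (Suc ?N) * ((1 / ?h w) ^ Suc ?N / Suc ?N) = 1 / ?h w ^ (?N + 1)"
      by (simp only: power_divide power_one Suc_eq_plus1) simp
    moreover have "0 \<le> (1 / ?h w) ^ Suc ?N / Suc ?N"
      using h_pos[of w] by (intro divide_nonneg_nonneg zero_le_power) auto
    ultimately have "of_nat (Suc ?N) * ennreal ((1 / ?h w) ^ Suc ?N / Suc ?N) =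
        ennreal (1 / ?h w ^ (?N + 1))"
      by (metis ennreal_mult ennreal_of_nat_eq_real_of_nat of_nat_0_le_iff)
    then show "of_nat (Suc ?N) * ((indicator E (sgn (w, 1)) + indicator E (- sgn (w, 1))) *
           ennreal ((1 / ?h w) ^ Suc ?N / Suc ?N)) =
        (indicator E (sgn (w, 1)) + indicator E (- sgn (w, 1))) * ennreal (1 / ?h w ^ (?N + 1))"
      by (simp only: mult.left_commute[of "of_nat (Suc ?N)"])
  qed
  finally show ?thesis .
qed

section \<open>Balls and the sets of the recursion\<close>

text \<open>
  A ball is represented by its centre and radius. All radii below are at most 1, hence less than \<open>pi\<close>,
  so that different representations denote different subsets of the sphere.
\<close>

type_synonym 'b gball = "'b \<times> real"

definition ball_pts :: "'b::euclidean_space gball \<Rightarrow> 'b set" where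
  "ball_pts B = {y \<in> sphere 0 1. geodesic_dist (fst B) y < snd B}"

definition separated :: "real \<Rightarrow> 'b::euclidean_space set \<Rightarrow> bool" where
  "separated \<epsilon> X \<longleftrightarrow>
     X \<subseteq> sphere 0 1 \<and> (\<forall>x\<in>X. \<forall>x'\<in>X. x \<noteq> x' \<longrightarrow> geodesic_dist x x' \<ge> \<epsilon>)"

definition maximal_separated :: "real \<Rightarrow> 'b::euclidean_space set \<Rightarrow> bool" where
  "maximal_separated \<epsilon> X \<longleftrightarrow> separated \<epsilon> X \<and> (\<forall>Y. separated \<epsilon> Y \<and> X \<subseteq> Y \<longrightarrow> Y = X)"

definition balls :: "(nat \<Rightarrow> 'b::euclidean_space set) \<Rightarrow> nat \<Rightarrow> 'b gball set" where
  "balls J k = {(x, 1 / 2 ^ k) | x. x \<in> J k}"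

text \<open>The level \<open>k\<close> of a ball is determined by its radius \<open>1 / 2 ^ k\<close>.\<close>

definition divide_ball ::
    "(nat \<Rightarrow> 'b::euclidean_space set) \<Rightarrow> 'b gball \<Rightarrow> 'b gball set" where
  "divide_ball J B =
     {B'. \<exists>k. B \<in> balls J k \<and> B' \<in> balls J (Suc k) \<and> ball_pts B' \<inter> ball_pts B \<noteq> {}}"

primrec level ::
    "(nat \<Rightarrow> 'b::euclidean_space set) \<Rightarrow> ('b \<Rightarrow> real) \<Rightarrow> nat \<Rightarrow> 'b gball set" where
  "level J f 0 = balls J 0"
| "level J f (Suc k) = \<Union> {divide_ball J B | B. B \<in> level J f k \<and> snd B \<ge> f (fst B)}"

definition accepted ::
    "(nat \<Rightarrow> 'b::euclidean_space set) \<Rightarrow> ('b \<Rightarrow> real) \<Rightarrow> nat \<Rightarrow> 'b gball set" where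
  "accepted J f k = (\<Union>i\<in>{0..k}. {B \<in> level J f i. snd B < f (fst B)})"

section \<open>The algorithm\<close>

text \<open>
  Body of the inner loop, acting on \<open>(L_final, L_next, number of evaluations of f)\<close>; every execution
  evaluates \<open>f\<close> once.
\<close>

fun process_ball ::
    "(nat \<Rightarrow> 'b::euclidean_space set) \<Rightarrow> ('b \<Rightarrow> real) \<Rightarrow> 'b gball \<Rightarrow>
     'b gball set \<times> 'b gball set \<times> nat \<Rightarrow> 'b gball set \<times> 'b gball set \<times> nat" where
  "process_ball J f (x, r) (F, N, m) =
     (if r < f x then (insert (x, r) F, N, Suc m) else (F, N \<union> divide_ball J (x, r), Suc m))"

text \<open>
  One iteration of the outer loop, acting on \<open>(L_todo, L_final, number of evaluations of f)\<close>. The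
  inner loop runs through \<open>L_todo\<close> in an arbitrary order \<open>Bs\<close>, visiting each ball once. An infinite
  \<open>L_todo\<close> has no enumeration \<open>Bs\<close>, and then there is no step: the inner loop would never end.
\<close>

inductive algo_step ::
    "(nat \<Rightarrow> 'b::euclidean_space set) \<Rightarrow> ('b \<Rightarrow> real) \<Rightarrow>
     'b gball set \<times> 'b gball set \<times> nat \<Rightarrow> 'b gball set \<times> 'b gball set \<times> nat \<Rightarrow> bool"
  for J f where
  "\<lbrakk>T \<noteq> {}; distinct Bs; set Bs = T; fold (process_ball J f) Bs (F, {}, m) = (F', N, m')\<rbrakk>
     \<Longrightarrow> algo_step J f (T, F, m) (N, F', m')"

definition algo_init ::
    "(nat \<Rightarrow> 'b::euclidean_space set) \<Rightarrow> 'b gball set \<times> 'b gball set \<times> nat" where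
  "algo_init J = (balls J 0, {}, 0)"

text \<open>
  Termination: there is no infinite execution, whatever the order of the inner loops, and no
  execution gets stuck in an infinite inner loop.
\<close>

definition algo_terminates ::
    "(nat \<Rightarrow> 'b::euclidean_space set) \<Rightarrow> ('b \<Rightarrow> real) \<Rightarrow> bool" where
  "algo_terminates J f \<longleftrightarrow>
     termip (algo_step J f) (algo_init J) \<and>
     (\<forall>T F m. (algo_step J f)\<^sup>*\<^sup>* (algo_init J) (T, F, m) \<and> T \<noteq> {}
        \<longrightarrow> (\<exists>s. algo_step J f (T, F, m) s))"

text \<open>Some execution returns \<open>F\<close> after \<open>m\<close> evaluations of \<open>f\<close>.\<close>

definition algo_returns ::
    "(nat \<Rightarrow> 'b::euclidean_space set) \<Rightarrow> ('b \<Rightarrow> real) \<Rightarrow> 'b gball set \<Rightarrow> nat \<Rightarrow> bool" where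
  "algo_returns J f F m \<longleftrightarrow> (algo_step J f)\<^sup>*\<^sup>* (algo_init J) ({}, F, m)"

end

theory Submission
  imports Defs
begin

text \<open>
  The number of evaluations is the total number of balls in the levels. The balls of level \<open>k\<close>,
  shrunk to half their radius, are disjoint, and each has volume at least a constant times
  \<open>(1 / 2 ^ (k + 1)) ^ n\<close>. A ball of level \<open>k > 0\<close> meets a parent \<open>B'\<close> with
  \<open>f (fst B') \<le> snd B' = 2 / 2 ^ k\<close>, so by the Lipschitz condition \<open>f \<le> (2 + 7 / 2 * A) / 2 ^ k\<close> on
  the half ball. Hence the half balls containing a point \<open>y\<close>, weighted by \<open>2 ^ (k * n)\<close>, contribute a
  truncated geometric sum that is bounded by a multiple of \<open>(1 / f y) ^ n\<close>; integrating over the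
  sphere gives the estimate. Since \<open>f\<close> is bounded below by a positive constant, the levels are
  eventually empty.
\<close>

section \<open>The Riemannian distance of the sphere\<close>

lemma has_integral_speed_reversepath:
  assumes "g piecewise_C1_differentiable_on {0..1}"
    and I: "((\<lambda>t. norm (vector_derivative g (at t))) has_integral l) {0..1}"
  shows "((\<lambda>t. norm (vector_derivative (reversepath g) (at t))) has_integral l) {0..1}"
proof -
  obtain S where S: "finite S" "g C1_differentiable_on {0..1} - S"
    using assms by (auto simp: piecewise_C1_differentiable_on_def)
  \<comment> \<open>Away from the reflected break points the chain rule changes only the sign of the
    velocity; the finitely many remaining points do not affect the integral.\<close>
  have eq: "norm (vector_derivative (reversepath g) (at x)) = norm (vector_derivative g (at (1 - x)))"
    if "x \<in> {0..1} - (\<lambda>x. 1 - x) ` S" for x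
  proof -
    have "1 - x \<in> {0..1} - S"
      using that by (auto simp: image_iff)
    then obtain g' where g': "(g has_vector_derivative g') (at (1 - x))"
      using S(2) unfolding C1_differentiable_on_def by blast
    have "(g \<circ> (\<lambda>x. 1 - x) has_vector_derivative -1 *\<^sub>R g') (at x)"
      by (intro vector_diff_chain_at g' derivative_eq_intros | simp)+
    then have "(reversepath g has_vector_derivative - g') (at x)"
      by (simp add: reversepath_def o_def)
    then show ?thesis
      using g' by (simp add: vector_derivative_at)
  qed
  have "((\<lambda>t. norm (vector_derivative g (at (1 - t)))) has_integral l) {0..1}"
    using has_integral_affinity01[where m = "-1" and c = 1, OF I] by simp
  with _ eq show ?thesis
    by (rule has_integral_spike_finite) (use S in auto)
qed

text \<open>Each curve is run at double speed in half the time, so the factor 2 cancels the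
  contraction of the interval. The junction \<open>1/2\<close> and the pulled back break points form
  a finite set, which the integral ignores. Working with \<open>has_integral\<close> carries
  integrability along with the value, as membership in \<open>sphere_curves\<close> demands.\<close>

lemma has_integral_speed_join:
  assumes "g1 piecewise_C1_differentiable_on {0..1}" "g2 piecewise_C1_differentiable_on {0..1}"
    and 1: "((\<lambda>t. norm (vector_derivative g1 (at t))) has_integral l1) {0..1}"
    and 2: "((\<lambda>t. norm (vector_derivative g2 (at t))) has_integral l2) {0..1}"
  shows "((\<lambda>t. norm (vector_derivative (g1 +++ g2) (at t))) has_integral l1 + l2) {0..1}"
proof -
  obtain S1 S2 where S1: "finite S1" "g1 C1_differentiable_on {0..1} - S1"
    and S2: "finite S2" "g2 C1_differentiable_on {0..1} - S2"
    using assms by (auto simp: piecewise_C1_differentiable_on_def)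
  have i1: "((\<lambda>t. 2 * norm (vector_derivative g1 (at (2 * t)))) has_integral l1) {0..1/2}"
    and i2: "((\<lambda>t. 2 * norm (vector_derivative g2 (at (2 * t - 1)))) has_integral l2) {1/2..1}"
    using has_integral_affinity01[OF 1, where m = 2 and c = 0, THEN has_integral_cmul[where c = 2]]
          has_integral_affinity01[OF 2, where m = 2 and c = "-1", THEN has_integral_cmul[where c = 2]]
    by (simp_all only: image_affinity_atLeastAtMost_div_diff, simp_all)
  have g1: "norm (vector_derivative (g1 +++ g2) (at z)) = 2 * norm (vector_derivative g1 (at (2 * z)))"
    if z: "0 \<le> z" "z < 1/2" "2 * z \<notin> S1" for z
  proof -
    have "2 * z \<in> {0..1} - S1"
      using z by auto
    then obtain g' where g': "(g1 has_vector_derivative g') (at (2 * z))"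
      using S1(2) unfolding C1_differentiable_on_def by blast
    have "((\<lambda>x. 2 * x) has_vector_derivative 2) (at z)"
      by (auto intro!: derivative_eq_intros)
    then have "(g1 \<circ> (\<lambda>x. 2 * x) has_vector_derivative 2 *\<^sub>R g') (at z)"
      using g' by (rule vector_diff_chain_at)
    then have "(g1 +++ g2 has_vector_derivative 2 *\<^sub>R g') (at z)"
      by (rule has_vector_derivative_transform_within[where d = "1/2 - z"])
        (use z in \<open>auto simp: joinpaths_def dist_real_def\<close>)
    then show ?thesis
      using g' by (simp add: vector_derivative_at)
  qed
  have g2: "norm (vector_derivative (g1 +++ g2) (at z)) = 2 * norm (vector_derivative g2 (at (2 * z - 1)))"
    if z: "1/2 < z" "z \<le> 1" "2 * z - 1 \<notin> S2" for z
  proof -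
    have "2 * z - 1 \<in> {0..1} - S2"
      using z by auto
    then obtain g' where g': "(g2 has_vector_derivative g') (at (2 * z - 1))"
      using S2(2) unfolding C1_differentiable_on_def by blast
    have "((\<lambda>x. 2 * x - 1) has_vector_derivative 2) (at z)"
      by (auto intro!: derivative_eq_intros)
    then have "(g2 \<circ> (\<lambda>x. 2 * x - 1) has_vector_derivative 2 *\<^sub>R g') (at z)"
      using g' by (rule vector_diff_chain_at)
    then have "(g1 +++ g2 has_vector_derivative 2 *\<^sub>R g') (at z)"
      by (rule has_vector_derivative_transform_within[where d = "z - 1/2"])
        (use z in \<open>auto simp: joinpaths_def dist_real_def\<close>)
    then show ?thesis
      using g' by (simp add: vector_derivative_at)
  qed
  have "((\<lambda>t. norm (vector_derivative (g1 +++ g2) (at t))) has_integral l1) {0..1/2}"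
  proof (rule has_integral_spike_finite[OF _ _ i1])
    show "finite (insert (1/2) ((*) 2 -` S1))"
      using S1 by (intro finite.insertI finite_vimageI) (auto intro: inj_onI)
  qed (use g1 in auto)
  moreover have "((\<lambda>t. norm (vector_derivative (g1 +++ g2) (at t))) has_integral l2) {1/2..1}"
  proof (rule has_integral_spike_finite[OF _ _ i2])
    show "finite (insert (1/2) ((\<lambda>x. 2 * x - 1) -` S2))"
      using S2 by (intro finite.insertI finite_vimageI) (auto intro: inj_onI)
  qed (use g2 in auto)
  ultimately show ?thesis
    by (rule has_integral_combine[where c = "1/2", rotated 2]) auto
qed

lemma sphere_curves_curve_length:
  assumes "\<gamma> piecewise_C1_differentiable_on {0..1}" "path_image \<gamma> \<subseteq> sphere 0 1"
    "pathstart \<gamma> = x" "pathfinish \<gamma> = y"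
    "((\<lambda>t. norm (vector_derivative \<gamma> (at t))) has_integral l) {0..1}"
  shows "\<gamma> \<in> sphere_curves x y" "curve_length \<gamma> = l"
  using assms by (auto simp: sphere_curves_def curve_length_def)

lemma sphere_curves_has_integral:
  assumes "\<gamma> \<in> sphere_curves x y"
  shows "((\<lambda>t. norm (vector_derivative \<gamma> (at t))) has_integral curve_length \<gamma>) {0..1}"
  using assms by (auto simp: sphere_curves_def curve_length_def)

text \<open>A speed that is not integrable has \<open>integral\<close> 0, so the bound holds for
  every curve. It supplies the lower bound that makes the infimum in \<open>geodesic_dist\<close>
  comparable with its members.\<close>

lemma curve_length_nonneg: "curve_length \<gamma> \<ge> 0"
  unfolding curve_length_def
  by (cases "(\<lambda>t. norm (vector_derivative \<gamma> (at t))) integrable_on {0..1}")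
    (auto intro: integral_nonneg simp: not_integrable_integral)

lemma sphere_curves_reversepath:
  assumes "\<gamma> \<in> sphere_curves x y"
  shows "reversepath \<gamma> \<in> sphere_curves y x" "curve_length (reversepath \<gamma>) = curve_length \<gamma>"
proof -
  have "reversepath \<gamma> piecewise_C1_differentiable_on {0..1}"
    using assms valid_path_reversepath[of \<gamma>] by (simp add: sphere_curves_def valid_path_def)
  moreover have "((\<lambda>t. norm (vector_derivative (reversepath \<gamma>) (at t))) has_integral curve_length \<gamma>) {0..1}"
    using assms
    by (intro has_integral_speed_reversepath sphere_curves_has_integral) (auto simp: sphere_curves_def)
  ultimately show "reversepath \<gamma> \<in> sphere_curves y x" "curve_length (reversepath \<gamma>) = curve_length \<gamma>"
    using assms by (auto intro!: sphere_curves_curve_length simp: sphere_curves_def)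
qed

lemma sphere_curves_join:
  assumes 1: "\<gamma>1 \<in> sphere_curves x y" and 2: "\<gamma>2 \<in> sphere_curves y z"
  shows "\<gamma>1 +++ \<gamma>2 \<in> sphere_curves x z"
    "curve_length (\<gamma>1 +++ \<gamma>2) = curve_length \<gamma>1 + curve_length \<gamma>2"
proof -
  have "\<gamma>1 +++ \<gamma>2 piecewise_C1_differentiable_on {0..1}"
    using assms valid_path_join[of \<gamma>1 \<gamma>2] by (simp add: sphere_curves_def valid_path_def)
  moreover have "((\<lambda>t. norm (vector_derivative (\<gamma>1 +++ \<gamma>2) (at t)))
      has_integral curve_length \<gamma>1 + curve_length \<gamma>2) {0..1}"
    using assms
    by (intro has_integral_speed_join sphere_curves_has_integral) (auto simp: sphere_curves_def)
  moreover have "path_image (\<gamma>1 +++ \<gamma>2) \<subseteq> sphere 0 1"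
    using assms by (intro subset_path_image_join) (auto simp: sphere_curves_def)
  ultimately show "\<gamma>1 +++ \<gamma>2 \<in> sphere_curves x z"
    "curve_length (\<gamma>1 +++ \<gamma>2) = curve_length \<gamma>1 + curve_length \<gamma>2"
    using assms by (auto intro!: sphere_curves_curve_length simp: sphere_curves_def)
qed

section \<open>Properties of the infimum distance\<close>

lemma bdd_below_curve_length: "bdd_below (curve_length ` C)"
  using curve_length_nonneg by (auto intro!: bdd_belowI[where m = 0])

lemma geodesic_dist_le: "\<gamma> \<in> sphere_curves x y \<Longrightarrow> geodesic_dist x y \<le> curve_length \<gamma>"
  unfolding geodesic_dist_def by (rule cINF_lower[OF bdd_below_curve_length])

lemma geodesic_dist_commute:
  fixes x y :: "'b::euclidean_space"
  shows "geodesic_dist x y = geodesic_dist y x"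
proof -
  have "curve_length ` sphere_curves x y \<subseteq> curve_length ` sphere_curves y x" for x y :: 'b
    using sphere_curves_reversepath[of _ x y] by (metis image_eqI image_subsetI)
  then show ?thesis
    unfolding geodesic_dist_def by (metis subset_antisym)
qed

text \<open>The curve turns in the plane of the orthonormal vectors \<open>x\<close> and
  \<open>u\<close> with constant speed \<open>\<theta>\<close>, so its length is the angle.\<close>

lemma great_circle:
  fixes x u :: "'b::euclidean_space"
  assumes "norm x = 1" "norm u = 1" "x \<bullet> u = 0" "\<theta> \<ge> 0"
  obtains \<gamma> where "\<gamma> \<in> sphere_curves x (cos \<theta> *\<^sub>R x + sin \<theta> *\<^sub>R u)" "curve_length \<gamma> = \<theta>"
proof -
  define \<gamma> where "\<gamma> = (\<lambda>t. cos (t * \<theta>) *\<^sub>R x + sin (t * \<theta>) *\<^sub>R u)"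
  define \<gamma>' where "\<gamma>' = (\<lambda>t. (- sin (t * \<theta>) * \<theta>) *\<^sub>R x + (cos (t * \<theta>) * \<theta>) *\<^sub>R u)"
  have inner: "x \<bullet> x = 1" "u \<bullet> u = 1" "u \<bullet> x = 0"
    using assms by (auto simp: norm_eq_1 inner_commute)
  have norm: "norm (a *\<^sub>R x + b *\<^sub>R u) = sqrt (a\<^sup>2 + b\<^sup>2)" for a b
    using inner assms(3)
    by (simp add: norm_eq_sqrt_inner inner_add_left inner_add_right power2_eq_square)
  have D: "(\<gamma> has_vector_derivative \<gamma>' t) (at t)" for t
    unfolding \<gamma>_def \<gamma>'_def by (auto intro!: derivative_eq_intros simp: mult.commute)
  have speed: "norm (vector_derivative \<gamma> (at t)) = \<theta>" for t
  proof -
    have "norm (\<gamma>' t) = sqrt (\<theta>\<^sup>2 * ((sin (t * \<theta>))\<^sup>2 + (cos (t * \<theta>))\<^sup>2))"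
      unfolding \<gamma>'_def norm by (simp only: power_mult_distrib power2_minus distrib_left mult.commute)
    also have "\<dots> = \<theta>"
      using assms(4) by (simp add: sin_cos_squared_add)
    finally show ?thesis
      using D[of t] by (simp add: vector_derivative_at)
  qed
  have "\<gamma> C1_differentiable_on {0..1}"
    unfolding C1_differentiable_on_def
  proof (intro exI conjI ballI)
    show "continuous_on {0..1} \<gamma>'"
      unfolding \<gamma>'_def by (intro continuous_intros)
  qed (rule D)
  then have "\<gamma> piecewise_C1_differentiable_on {0..1}"
    by (rule C1_differentiable_imp_piecewise)
  moreover have "path_image \<gamma> \<subseteq> sphere 0 1"
    by (auto simp: path_image_def \<gamma>_def norm)
  moreover have "((\<lambda>t. norm (vector_derivative \<gamma> (at t))) has_integral \<theta>) {0..1}"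
    unfolding speed using has_integral_const_real[of \<theta> 0 1] by simp
  moreover have "pathstart \<gamma> = x" "pathfinish \<gamma> = cos \<theta> *\<^sub>R x + sin \<theta> *\<^sub>R u"
    by (auto simp: pathstart_def pathfinish_def \<gamma>_def)
  ultimately show ?thesis
    using sphere_curves_curve_length that by blast
qed

text \<open>This provides both the upper estimate of the distance and the non-emptiness of
  \<open>sphere_curves x y\<close>, which lower estimates of the infimum require. Removing from
  \<open>y\<close> its component along \<open>x\<close> leaves \<open>sqrt (1 - c\<^sup>2)\<close>
  times a unit vector \<open>u\<close> orthogonal to \<open>x\<close>.\<close>

lemma sphere_curve_arccos:
  fixes x y :: "'b::euclidean_space"
  assumes "2 \<le> DIM('b)" and x: "x \<in> sphere 0 1" and y: "y \<in> sphere 0 1"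
  obtains \<gamma> where "\<gamma> \<in> sphere_curves x y" "curve_length \<gamma> = arccos (x \<bullet> y)"
proof -
  define c where "c = x \<bullet> y"
  have [simp]: "norm x = 1" "norm y = 1"
    using x y by auto
  then have [simp]: "x \<bullet> x = 1" "y \<bullet> y = 1"
    by (metis norm_eq_1)+
  have "\<bar>c\<bar> \<le> 1"
    using Cauchy_Schwarz_ineq2[of x y] by (simp add: c_def)
  then have c: "cos (arccos c) = c" "0 \<le> arccos c" "sin (arccos c) = sqrt (1 - c\<^sup>2)"
    by (auto simp: sin_arccos_abs arccos_lbound)
  have "\<exists>u. norm u = 1 \<and> x \<bullet> u = 0 \<and> y = c *\<^sub>R x + sqrt (1 - c\<^sup>2) *\<^sub>R u"
  proof (cases "y = c *\<^sub>R x")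
    \<comment> \<open>Here \<open>y\<close> is \<open>x\<close> or \<open>- x\<close>, so the
      remainder vanishes and any orthogonal direction serves; dimension at least 2 supplies
      one.\<close>
    case True
    then have "\<bar>c\<bar> = 1"
      using \<open>norm y = 1\<close> by simp
    then have "c\<^sup>2 = 1"
      by (simp add: abs_square_eq_1)
    obtain v where "v \<noteq> 0" "orthogonal v x"
      using orthogonal_to_vector_exists[OF assms(1), of x] orthogonal_commute by metis
    then have "norm (sgn v) = 1" "x \<bullet> sgn v = 0"
      by (auto simp: norm_sgn sgn_div_norm orthogonal_def inner_commute)
    with True \<open>c\<^sup>2 = 1\<close> show ?thesis by auto
  next
    case False
    define v where "v = y - c *\<^sub>R x"
    have "x \<bullet> v = 0"
      by (simp add: v_def c_def inner_diff_right)
    moreover have "v \<bullet> v = 1 - c\<^sup>2"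
      by (simp add: v_def c_def inner_diff_right inner_diff_left inner_commute power2_eq_square)
    then have "norm v = sqrt (1 - c\<^sup>2)"
      by (simp add: norm_eq_sqrt_inner)
    ultimately show ?thesis
      using False by (intro exI[of _ "sgn v"])
        (simp add: v_def norm_sgn sgn_div_norm flip: \<open>norm v = _\<close>)
  qed
  then obtain u where "norm u = 1" "x \<bullet> u = 0" "y = c *\<^sub>R x + sqrt (1 - c\<^sup>2) *\<^sub>R u"
    by blast
  then show ?thesis
    using great_circle[of x u "arccos c"] c that by (auto simp: c_def)
qed

lemma geodesic_dist_le_arccos:
  fixes x y :: "'b::euclidean_space"
  assumes "2 \<le> DIM('b)" "x \<in> sphere 0 1" "y \<in> sphere 0 1"
  shows "geodesic_dist x y \<le> arccos (x \<bullet> y)"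
  using sphere_curve_arccos[OF assms] geodesic_dist_le by metis

lemma geodesic_dist_nonneg:
  fixes x y :: "'b::euclidean_space"
  assumes "2 \<le> DIM('b)" "x \<in> sphere 0 1" "y \<in> sphere 0 1"
  shows "0 \<le> geodesic_dist x y"
  unfolding geodesic_dist_def
  by (rule cINF_greatest) (use sphere_curve_arccos[OF assms] curve_length_nonneg in auto)

lemma geodesic_dist_refl:
  fixes x :: "'b::euclidean_space"
  assumes "2 \<le> DIM('b)" "x \<in> sphere 0 1"
  shows "geodesic_dist x x = 0"
  using geodesic_dist_le_arccos[OF assms assms(2)] geodesic_dist_nonneg[OF assms assms(2)] assms(2)
  by (simp add: norm_eq_1)

text \<open>Concatenation bounds the distance by the sum of two lengths; the infimum is taken first
  over the second curve with the first one fixed, then over the first.\<close>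

lemma geodesic_dist_triangle:
  fixes x y z :: "'b::euclidean_space"
  assumes "2 \<le> DIM('b)" "x \<in> sphere 0 1" "y \<in> sphere 0 1" "z \<in> sphere 0 1"
  shows "geodesic_dist x z \<le> geodesic_dist x y + geodesic_dist y z"
proof -
  have "geodesic_dist x z - curve_length \<gamma>1 \<le> curve_length \<gamma>2"
    if "\<gamma>1 \<in> sphere_curves x y" "\<gamma>2 \<in> sphere_curves y z" for \<gamma>1 \<gamma>2
    using sphere_curves_join[OF that] geodesic_dist_le by fastforce
  then have "geodesic_dist x z - curve_length \<gamma>1 \<le> geodesic_dist y z"
    if "\<gamma>1 \<in> sphere_curves x y" for \<gamma>1
    unfolding geodesic_dist_def[of y z]
    by (intro cINF_greatest) (use that sphere_curve_arccos[OF assms(1,3,4)] in auto)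
  then have "geodesic_dist x z - geodesic_dist y z \<le> geodesic_dist x y"
    unfolding geodesic_dist_def[of x y]
    by (intro cINF_greatest) (use sphere_curve_arccos[OF assms(1-3)] in \<open>auto simp: algebra_simps\<close>)
  then show ?thesis by simp
qed

text \<open>The threshold is \<open>cos (arctan r)\<close>, and \<open>arctan r \<le> r\<close>. It
  is chosen because the cap it cuts out is exactly the Euclidean ball of radius \<open>r\<close> in
  the central chart.\<close>

lemma geodesic_dist_less:
  fixes x y :: "'b::euclidean_space"
  assumes "2 \<le> DIM('b)" "x \<in> sphere 0 1" "y \<in> sphere 0 1"
    and "0 < r" and xy: "1 / sqrt (1 + r\<^sup>2) < x \<bullet> y"
  shows "geodesic_dist x y < r"
proof -
  have "x \<bullet> y \<le> 1"
    using norm_cauchy_schwarz[of x y] assms by simp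
  moreover have "-1 \<le> 1 / sqrt (1 + r\<^sup>2)"
    by (smt (verit) divide_nonneg_nonneg real_sqrt_ge_zero zero_le_power2)
  ultimately have "arccos (x \<bullet> y) < arccos (1 / sqrt (1 + r\<^sup>2))"
    using xy by (intro arccos_less_arccos) auto
  also have "1 / sqrt (1 + r\<^sup>2) = cos (arctan r)"
    by (simp add: cos_arctan)
  also have "arccos \<dots> = arctan r"
    using \<open>0 < r\<close> arctan_bounded[of r] by (intro arccos_cos) (auto simp: less_imp_le)
  also have "\<dots> \<le> r"
    using \<open>0 < r\<close> by (simp add: arctan_le_self)
  finally show ?thesis
    using geodesic_dist_le_arccos[OF assms(1-3)] by simp
qed

text \<open>Continuity refers to the Euclidean topology, while the hypothesis speaks of the geodesic
  distance. The link is the bound \<open>A * arccos (x \<bullet> y)\<close>, which tends to 0 as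
  \<open>y\<close> tends to \<open>x\<close>.\<close>

lemma continuous_on_lipschitz_geodesic:
  fixes f :: "'b::euclidean_space \<Rightarrow> real"
  assumes dim: "2 \<le> DIM('b)"
    and lip: "\<And>x y. x \<in> sphere 0 1 \<Longrightarrow> y \<in> sphere 0 1 \<Longrightarrow> \<bar>f x - f y\<bar> \<le> A * geodesic_dist x y"
    and A: "A \<ge> 0"
  shows "continuous_on (sphere 0 1) f"
  unfolding continuous_on_def
proof
  fix x :: 'b assume x: "x \<in> sphere 0 1"
  have "-1 \<le> x \<bullet> y \<and> x \<bullet> y \<le> 1" if "y \<in> sphere 0 1" for y
    using x that Cauchy_Schwarz_ineq2[of x y] by (simp add: abs_le_iff)
  then have "continuous_on (sphere 0 1) (\<lambda>y. A * arccos (x \<bullet> y))"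
    by (intro continuous_intros) auto
  then have "((\<lambda>y. A * arccos (x \<bullet> y)) \<longlongrightarrow> A * arccos (x \<bullet> x)) (at x within sphere 0 1)"
    using x by (auto simp: continuous_on_def)
  then have lim: "((\<lambda>y. A * arccos (x \<bullet> y)) \<longlongrightarrow> 0) (at x within sphere 0 1)"
    using x by (simp add: norm_eq_1)
  have "norm (f y - f x) \<le> A * arccos (x \<bullet> y)" if "y \<in> sphere 0 1" for y
    using lip[OF x that] mult_left_mono[OF geodesic_dist_le_arccos[OF dim x that] A]
    by (simp add: abs_minus_commute)
  then have "\<forall>\<^sub>F y in at x within sphere 0 1. norm (f y - f x) \<le> A * arccos (x \<bullet> y)"
    by (auto simp: eventually_at_filter)
  from Lim_null_comparison[OF this lim] show "(f \<longlongrightarrow> f x) (at x within sphere 0 1)"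
    by (simp add: LIM_zero_iff)
qed

text \<open>By the triangle inequality the distance to the centre is 1-Lipschitz, hence continuous,
  and the ball is the preimage of an open half-line.\<close>

lemma openin_ball_pts:
  fixes B :: "'b::euclidean_space gball"
  assumes dim: "2 \<le> DIM('b)" and c: "fst B \<in> sphere 0 1"
  shows "openin (top_of_set (sphere 0 1)) (ball_pts B)"
proof -
  have "continuous_on (sphere 0 1) (geodesic_dist (fst B))"
  proof (rule continuous_on_lipschitz_geodesic[OF dim, where A = 1])
    fix x y :: 'b assume "x \<in> sphere 0 1" "y \<in> sphere 0 1"
    then show "\<bar>geodesic_dist (fst B) x - geodesic_dist (fst B) y\<bar> \<le> 1 * geodesic_dist x y"
      using geodesic_dist_triangle[OF dim c, of x y] geodesic_dist_triangle[OF dim c, of y x]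
        geodesic_dist_commute[of x y] by auto
  qed simp
  then have "openin (top_of_set (sphere 0 1)) (sphere 0 1 \<inter> geodesic_dist (fst B) -` {..<snd B})"
    by (intro continuous_openin_preimage_gen) auto
  moreover have "sphere 0 1 \<inter> geodesic_dist (fst B) -` {..<snd B} = ball_pts B"
    by (auto simp: ball_pts_def)
  ultimately show ?thesis by simp
qed

section \<open>Volumes of caps\<close>

lemma sgn_borel_measurable [measurable]: "(sgn :: 'b::euclidean_space \<Rightarrow> 'b) \<in> borel_measurable borel"
proof -
  have "(\<lambda>x::'b. x /\<^sub>R norm x) \<in> borel_measurable borel" by measurable
  then show ?thesis by (simp add: sgn_div_norm[abs_def])
qed

lemma nn_integral_lborel_translate:
  fixes g :: "'b::euclidean_space \<Rightarrow> ennreal"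
  assumes [measurable]: "g \<in> borel_measurable borel"
  shows "(\<integral>\<^sup>+x. g (a + x) \<partial>lborel) = (\<integral>\<^sup>+x. g x \<partial>lborel)"
  by (subst (2) lborel_distr_plus[of a, symmetric]) (simp add: nn_integral_distr)

text \<open>
  Uniqueness of Haar measure: the image of Lebesgue measure under \<open>T\<close> is translation invariant, and
  Tonelli's theorem for \<open>indicator X (T x) * indicator ?U (y - T x)\<close> identifies it with Lebesgue
  measure, because both have the same finite value on the symmetric set \<open>?U = ball 0 1\<close>.
\<close>

lemma emeasure_lborel_orthogonal_vimage:
  fixes T :: "'b::euclidean_space \<Rightarrow> 'b"
  assumes T: "orthogonal_transformation T" and X [measurable]: "X \<in> sets borel"
  shows "emeasure lborel (T -` X) = emeasure lborel X"
proof -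
  let ?U = "ball 0 1 :: 'b set"
  have T_linear: "linear T"
    using T by (rule orthogonal_transformation_linear)
  then have [measurable]: "T \<in> borel_measurable borel"
    by (intro borel_measurable_continuous_onI linear_continuous_on)
      (simp add: linear_conv_bounded_linear)
  have [measurable]: "?U \<in> sets borel" by simp
  have U_T: "indicator ?U (T x) = (indicator ?U x :: ennreal)" for x
    using orthogonal_transformation_norm[OF T] by (simp add: indicator_def)
  have U_neg: "indicator ?U (- x) = (indicator ?U x :: ennreal)" for x
    by (simp add: indicator_def)
  have ind: "(\<integral>\<^sup>+x. indicator X (T x) \<partial>lborel) = emeasure lborel (T -` X)"
  proof -
    have "(\<integral>\<^sup>+x. indicator X (T x) \<partial>lborel) = (\<integral>\<^sup>+x. indicator (T -` X) x \<partial>lborel)"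
      by (simp add: indicator_def vimage_def)
    also have "\<dots> = emeasure lborel (T -` X)"
      using measurable_sets_borel[of T borel X] by (intro nn_integral_indicator) simp
    finally show ?thesis .
  qed
  have "emeasure lborel (T -` X) * emeasure lborel ?U
      = (\<integral>\<^sup>+x. indicator X (T x) * (\<integral>\<^sup>+y. indicator ?U y \<partial>lborel) \<partial>lborel)"
    by (simp add: nn_integral_multc ind)
  also have "\<dots> = (\<integral>\<^sup>+x. indicator X (T x) * (\<integral>\<^sup>+y. indicator ?U (- T x + y) \<partial>lborel) \<partial>lborel)"
    by (subst nn_integral_lborel_translate) auto
  also have "\<dots> = (\<integral>\<^sup>+x. \<integral>\<^sup>+y. indicator X (T x) * indicator ?U (y - T x) \<partial>lborel \<partial>lborel)"
    by (simp add: nn_integral_cmult)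
  also have "\<dots> = (\<integral>\<^sup>+y. \<integral>\<^sup>+x. indicator X (T x) * indicator ?U (y - T x) \<partial>lborel \<partial>lborel)"
    by (rule lborel_pair.Fubini'[symmetric]) measurable
  also have "\<dots> = (\<integral>\<^sup>+y. \<integral>\<^sup>+x. indicator X (y + T x) * indicator ?U x \<partial>lborel \<partial>lborel)"
  proof (rule nn_integral_cong)
    fix y :: 'b
    obtain a where a: "T a = y"
      using orthogonal_transformation_surj[OF T] by (metis surjD)
    have "(\<integral>\<^sup>+x. indicator X (T x) * indicator ?U (y - T x) \<partial>lborel)
        = (\<integral>\<^sup>+x. indicator X (T (a + x)) * indicator ?U (y - T (a + x)) \<partial>lborel)"
      by (subst nn_integral_lborel_translate) auto
    also have "\<dots> = (\<integral>\<^sup>+x. indicator X (y + T x) * indicator ?U x \<partial>lborel)"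
      by (simp add: linear_add[OF T_linear] a U_neg U_T)
    finally show "(\<integral>\<^sup>+x. indicator X (T x) * indicator ?U (y - T x) \<partial>lborel) = \<dots>" .
  qed
  also have "\<dots> = (\<integral>\<^sup>+x. \<integral>\<^sup>+y. indicator X (y + T x) * indicator ?U x \<partial>lborel \<partial>lborel)"
    by (rule lborel_pair.Fubini') measurable
  also have "\<dots> = (\<integral>\<^sup>+x. (\<integral>\<^sup>+y. indicator X (T x + y) \<partial>lborel) * indicator ?U x \<partial>lborel)"
    by (simp add: nn_integral_multc add.commute)
  also have "\<dots> = emeasure lborel X * emeasure lborel ?U"
    by (simp add: nn_integral_lborel_translate nn_integral_cmult)
  finally have "emeasure lborel ?U * emeasure lborel (T -` X) = emeasure lborel ?U * emeasure lborel X"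
    by (simp only: mult.commute)
  moreover have "unit_ball_vol (real DIM('b)) \<noteq> 0"
    by (metis less_irrefl of_nat_0_le_iff unit_ball_vol_pos)
  ultimately show ?thesis
    by (auto simp: emeasure_ball ennreal_mult_cancel_left)
qed

text \<open>For distinct points \<open>T\<close> is the reflection in the hyperplane orthogonal to
  \<open>x - y\<close>; equality of the norms makes it send \<open>x\<close> to
  \<open>y\<close>.\<close>

lemma exists_orthogonal_transformation:
  fixes x y :: "'b::euclidean_space"
  assumes "norm x = norm y"
  obtains T where "orthogonal_transformation T" "T x = y"
proof (cases "x = y")
  case True
  then show ?thesis
    using that[of "\<lambda>x. x"] by simp
next
  case False
  define u where "u = x - y"
  define T where "T v = v - (2 * (v \<bullet> u) / (u \<bullet> u)) *\<^sub>R u" for v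
  have "u \<bullet> u \<noteq> 0"
    using False by (simp add: u_def)
  have "linear T"
    by (rule linearI) (simp_all add: T_def inner_add_left algebra_simps add_divide_distrib)
  moreover have "T v \<bullet> T w = v \<bullet> w" for v w
    using \<open>u \<bullet> u \<noteq> 0\<close>
    by (simp add: T_def inner_diff_left inner_diff_right inner_commute field_simps)
  moreover have "T x = y"
  proof -
    have "x \<bullet> x = y \<bullet> y"
      using assms by (simp add: norm_eq)
    then have "2 * (x \<bullet> u) = u \<bullet> u"
      by (simp add: u_def inner_diff_left inner_diff_right inner_commute)
    then show ?thesis
      using \<open>u \<bullet> u \<noteq> 0\<close> by (simp add: T_def) (simp add: u_def)
  qed
  ultimately show ?thesis
    using that[of T] by (simp add: orthogonal_transformation_def)
qed

text \<open>An orthogonal map commutes with \<open>sgn\<close> and preserves norms, so the cone over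
  the preimage of \<open>E\<close> is the preimage of the cone over \<open>E\<close>.\<close>

lemma emeasure_sphere_measure_orthogonal_vimage:
  fixes T :: "'b::euclidean_space \<Rightarrow> 'b"
  assumes T: "orthogonal_transformation T" and E: "E \<in> sets borel" "E \<subseteq> sphere 0 1"
  shows "emeasure sphere_measure (T -` E) = emeasure sphere_measure E"
proof -
  have T_linear: "linear T" and norm_T: "norm (T x) = norm x" for x
    using T by (auto simp: orthogonal_transformation_linear orthogonal_transformation_norm)
  have [measurable]: "T \<in> borel_measurable borel"
    using T_linear by (intro borel_measurable_continuous_onI linear_continuous_on)
      (simp add: linear_conv_bounded_linear)
  have [measurable]: "E \<in> sets borel" by fact
  have "T -` E \<in> sets borel"
    using measurable_sets_borel[of T borel E] by simp
  moreover have "T -` E \<subseteq> sphere 0 1"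
    using E(2) norm_T by (auto simp: subset_iff)
  moreover have "{x. x \<noteq> 0 \<and> norm x < 1 \<and> sgn x \<in> T -` E} = T -` {x. x \<noteq> 0 \<and> norm x < 1 \<and> sgn x \<in> E}"
  proof -
    have "T (sgn x) = sgn (T x)" for x
      by (simp add: sgn_div_norm norm_T linear_cmul[OF T_linear])
    moreover have "T x = 0 \<longleftrightarrow> x = 0" for x
      using norm_T[of x] by (metis norm_eq_zero)
    ultimately show ?thesis
      using norm_T by auto
  qed
  moreover have "{x. x \<noteq> 0 \<and> norm x < 1 \<and> sgn x \<in> E} \<in> sets borel"
    by measurable
  ultimately show ?thesis
    by (simp only: emeasure_sphere_measure[OF E] emeasure_sphere_measure emeasure_lborel_orthogonal_vimage[OF T])
qed

text \<open>The cone over the whole sphere is the punctured unit ball. On \<open>'a\<close> this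
  evaluates the constant A_n; on \<open>'a \<times> real\<close> it shows that the volume is finite
  and positive.\<close>

lemma emeasure_sphere_measure_sphere:
  "emeasure sphere_measure (sphere (0::'b::euclidean_space) 1) = ennreal (DIM('b) * unit_ball_vol DIM('b))"
proof -
  have "{x::'b. x \<noteq> 0 \<and> norm x < 1 \<and> sgn x \<in> sphere 0 1} = ball 0 1 - {0}"
    by (auto simp: norm_sgn)
  moreover have "emeasure lborel (ball (0::'b) 1 - {0}) = emeasure lborel (ball (0::'b) 1)"
    by (subst emeasure_Diff) auto
  ultimately show ?thesis
    by (simp add: emeasure_sphere_measure emeasure_ball ennreal_mult ennreal_of_nat_eq_real_of_nat)
qed

section \<open>Finiteness of the volume and lower bounds for caps\<close>

lemma
  space_sphere_measure: "space (sphere_measure :: 'b::euclidean_space measure) = sphere 0 1" and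
  sets_sphere_measure: "sets (sphere_measure :: 'b measure) = sets (restrict_space borel (sphere 0 1))"
  by (simp_all add: sphere_measure_def space_scale_measure space_restrict_space)

lemma finite_measure_sphere_measure: "finite_measure (sphere_measure :: 'b::euclidean_space measure)"
  by (rule finite_measureI) (simp add: space_sphere_measure emeasure_sphere_measure_sphere)

text \<open>
  In the central chart at \<open>x\<close> the cap is the Euclidean ball of radius \<open>r\<close>, where the density
  \<open>1 / sqrt (1 + (norm w)^2) ^ (DIM('a) + 1)\<close> is at least \<open>(7 / 8) ^ (DIM('a) + 1)\<close>.
\<close>

lemma measure_cap_ge:
  fixes x :: "'a::euclidean_space \<times> real"
  assumes x: "x \<in> sphere 0 1" and r: "0 < r" "r \<le> 1 / 2"
  shows "(7 / 8) ^ (DIM('a) + 1) * (unit_ball_vol DIM('a) * r ^ DIM('a))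
    \<le> measure sphere_measure {y \<in> sphere 0 1. 1 / sqrt (1 + r\<^sup>2) < x \<bullet> y}"
proof -
  let ?cap = "\<lambda>x::'a \<times> real. {y \<in> sphere 0 1. 1 / sqrt (1 + r\<^sup>2) < x \<bullet> y}"
  let ?p = "(0, 1) :: 'a \<times> real"
  let ?h = "\<lambda>w::'a. sqrt (1 + (norm w)\<^sup>2)"
  interpret finite_measure "sphere_measure :: ('a \<times> real) measure"
    by (rule finite_measure_sphere_measure)
  \<comment> \<open>An orthogonal map moves the centre to the pole \<open>(0, 1)\<close>, about
    which the chart formula is written, without changing the volume of the cap.\<close>
  obtain T where T: "orthogonal_transformation T" "T x = ?p"
    using exists_orthogonal_transformation[of x ?p] x by (auto simp: norm_Pair)
  have cap [measurable]: "?cap z \<in> sets borel" for z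
    by measurable
  have "T x \<bullet> T y = x \<bullet> y" for y
    using T(1) by (simp only: orthogonal_transformation_def)
  then have "?cap x = T -` ?cap (T x)"
    using orthogonal_transformation_norm[OF T(1)] by (simp add: vimage_def)
  then have "?cap x = T -` ?cap ?p"
    by (simp only: T(2))
  moreover have "?cap ?p \<subseteq> sphere 0 1"
    by blast
  ultimately have "emeasure sphere_measure (?cap x) = emeasure sphere_measure (?cap ?p)"
    by (simp only: emeasure_sphere_measure_orthogonal_vimage[OF T(1) cap])
  also have "\<dots> \<ge> ennreal ((7 / 8) ^ (DIM('a) + 1) * (unit_ball_vol DIM('a) * r ^ DIM('a)))"
  proof -
    have "ennreal ((7 / 8) ^ (DIM('a) + 1) * (unit_ball_vol DIM('a) * r ^ DIM('a)))
        = (\<integral>\<^sup>+w. ennreal ((7 / 8) ^ (DIM('a) + 1)) * indicator (ball (0::'a) r) w \<partial>lborel)"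
      using r by (subst nn_integral_cmult_indicator) (auto simp: emeasure_ball simp flip: ennreal_mult)
    also have "\<dots> \<le> (\<integral>\<^sup>+w. (indicator (?cap ?p) (sgn (w, 1)) + indicator (?cap ?p) (- sgn (w, 1))) *
           ennreal (1 / ?h w ^ (DIM('a) + 1)) \<partial>lborel)"
    proof (rule nn_integral_mono)
      fix w :: 'a
      show "ennreal ((7 / 8) ^ (DIM('a) + 1)) * indicator (ball 0 r) w
        \<le> (indicator (?cap ?p) (sgn (w, 1)) + indicator (?cap ?p) (- sgn (w, 1))) *
           ennreal (1 / ?h w ^ (DIM('a) + 1))"
      proof (cases "norm w < r")
        case True
        then have "(norm w)\<^sup>2 < r\<^sup>2"
          by (simp add: power_strict_mono)
        moreover have "r\<^sup>2 \<le> (1 / 2)\<^sup>2"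
          using r by (intro power_mono) auto
        \<comment> \<open>As \<open>r \<le> 1 / 2\<close>, the radicand is below
          \<open>5 / 4\<close>, which is less than \<open>(8 / 7)\<^sup>2\<close>.\<close>
        ultimately have "?h w \<le> sqrt ((8 / 7)\<^sup>2)"
          by (intro real_sqrt_le_mono) (simp add: power2_eq_square)
        then have h: "0 < ?h w" "?h w \<le> 8 / 7"
          by (simp_all add: add_pos_nonneg)
        then have "7 / 8 \<le> 1 / ?h w"
          by (simp add: field_simps)
        then have le: "(7 / 8) ^ (DIM('a) + 1) \<le> 1 / ?h w ^ (DIM('a) + 1)"
          unfolding power_one_over[symmetric] by (intro power_mono) (auto simp: power_one_over)
        have nw: "norm (w, 1::real) = ?h w"
          by (simp add: norm_Pair add.commute)
        have "?p \<bullet> sgn (w, 1) = 1 / ?h w"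
          by (simp add: sgn_div_norm nw inverse_eq_divide)
        moreover have "1 / sqrt (1 + r\<^sup>2) < 1 / ?h w"
          using \<open>(norm w)\<^sup>2 < r\<^sup>2\<close> h(1) by (intro divide_strict_left_mono mult_pos_pos) (auto intro: add_pos_nonneg)
        moreover have "norm (sgn (w, 1::real)) = 1"
          by (simp add: norm_sgn) (simp add: zero_prod_def)
        ultimately have "sgn (w, 1) \<in> ?cap ?p"
          by simp
        \<comment> \<open>The factor 1 bounds the sum of the two indicators from below, because
          \<open>sgn (w, 1)\<close> lies in the cap.\<close>
        then have "1 * ennreal ((7 / 8) ^ (DIM('a) + 1)) \<le> (indicator (?cap ?p) (sgn (w, 1)) + indicator (?cap ?p) (- sgn (w, 1))) *
            ennreal (1 / ?h w ^ (DIM('a) + 1))"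
          using le by (intro mult_mono ennreal_leI) (auto simp: indicator_def)
        then show ?thesis
          using True by simp
      qed simp
    qed
    also have "\<dots> = emeasure sphere_measure (?cap ?p)"
      by (rule emeasure_sphere_measure_charts[symmetric]) auto
    finally show ?thesis .
  qed
  finally show ?thesis
    using r by (simp add: emeasure_eq_measure)
qed

section \<open>Counting the balls of the recursion\<close>

lemma DIM_prod_real_ge_2: "2 \<le> DIM('a::euclidean_space \<times> real)"
  using DIM_positive[where 'a = 'a] by simp

lemma sets_ball_pts:
  fixes B :: "('a::euclidean_space \<times> real) gball"
  assumes "fst B \<in> sphere 0 1"
  shows "ball_pts B \<in> sets sphere_measure"
proof -
  obtain T where "open T" "ball_pts B = sphere 0 1 \<inter> T"
    using openin_ball_pts[OF DIM_prod_real_ge_2 assms] by (auto simp: openin_open)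
  then show ?thesis
    by (auto simp: sets_sphere_measure sets_restrict_space)
qed

lemma measure_ball_pts_ge:
  fixes x :: "'a::euclidean_space \<times> real"
  assumes x: "x \<in> sphere 0 1" and r: "0 < r" "r \<le> 1 / 2"
  shows "(7 / 8) ^ (DIM('a) + 1) * (unit_ball_vol DIM('a) * r ^ DIM('a))
    \<le> measure sphere_measure (ball_pts (x, r))"
proof -
  interpret finite_measure "sphere_measure :: ('a \<times> real) measure"
    by (rule finite_measure_sphere_measure)
  have "{y \<in> sphere 0 1. 1 / sqrt (1 + r\<^sup>2) < x \<bullet> y} \<subseteq> ball_pts (x, r)"
    using geodesic_dist_less[OF DIM_prod_real_ge_2 x] r by (auto simp: ball_pts_def)
  then have "measure sphere_measure {y \<in> sphere 0 1. 1 / sqrt (1 + r\<^sup>2) < x \<bullet> y}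
      \<le> measure sphere_measure (ball_pts (x, r))"
    using x by (intro finite_measure_mono sets_ball_pts) auto
  with measure_cap_ge[OF assms] show ?thesis
    by linarith
qed

text \<open>A point common to two half balls would put their centres at distance less than
  \<open>\<epsilon>\<close>.\<close>

lemma separated_disjoint_ball_pts:
  fixes X :: "('a::euclidean_space \<times> real) set"
  assumes "separated \<epsilon> X"
  shows "disjoint_family_on (\<lambda>x. ball_pts (x, \<epsilon> / 2)) X"
  unfolding disjoint_family_on_def
proof (intro ballI impI equals0I)
  fix x x' y assume x: "x \<in> X" "x' \<in> X" "x \<noteq> x'"
    and "y \<in> ball_pts (x, \<epsilon> / 2) \<inter> ball_pts (x', \<epsilon> / 2)"
  then have y: "y \<in> sphere 0 1" "geodesic_dist x y < \<epsilon> / 2" "geodesic_dist y x' < \<epsilon> / 2"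
    by (auto simp: ball_pts_def geodesic_dist_commute)
  have "x \<in> sphere 0 1" "x' \<in> sphere 0 1" "\<epsilon> \<le> geodesic_dist x x'"
    using assms x by (auto simp: separated_def)
  with y geodesic_dist_triangle[OF DIM_prod_real_ge_2, of x y x'] show False
    by auto
qed

text \<open>Packing argument: the disjoint half balls have volume at least \<open>v\<close> each
  inside a space of finite volume, which bounds the size of all finite subsets uniformly.\<close>

lemma finite_separated:
  fixes X :: "('a::euclidean_space \<times> real) set"
  assumes sep: "separated \<epsilon> X" and "0 < \<epsilon>" "\<epsilon> \<le> 1"
  shows "finite X"
proof -
  interpret finite_measure "sphere_measure :: ('a \<times> real) measure"
    by (rule finite_measure_sphere_measure)
  let ?V = "measure (sphere_measure :: ('a \<times> real) measure) (space sphere_measure)"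
  define v where "v = (7 / 8) ^ (DIM('a) + 1) * (unit_ball_vol DIM('a) * (\<epsilon> / 2) ^ DIM('a))"
  have "v > 0"
    using assms by (simp add: v_def)
  have "card G \<le> nat \<lfloor>?V / v\<rfloor>" if G: "G \<subseteq> X" "finite G" for G
  proof -
    have sph: "x \<in> sphere 0 1" if "x \<in> G" for x
      using that G sep by (auto simp: separated_def)
    have "real (card G) * v = (\<Sum>x\<in>G. v)"
      by simp
    also have "\<dots> \<le> (\<Sum>x\<in>G. measure sphere_measure (ball_pts (x, \<epsilon> / 2)))"
      unfolding v_def using sph assms by (intro sum_mono measure_ball_pts_ge) auto
    also have "\<dots> = measure sphere_measure (\<Union>x\<in>G. ball_pts (x, \<epsilon> / 2))"
      using G sph disjoint_family_on_mono[OF G(1) separated_disjoint_ball_pts[OF sep]]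
      by (intro finite_measure_finite_Union[symmetric]) (auto intro!: sets_ball_pts)
    also have "\<dots> \<le> ?V"
      by (rule bounded_measure)
    finally have "real (card G) \<le> ?V / v"
      using \<open>v > 0\<close> by (simp add: field_simps)
    then show ?thesis
      by (simp add: le_nat_floor)
  qed
  then show ?thesis
    by (metis finite_if_finite_subsets_card_bdd)
qed

text \<open>An uncovered \<open>y\<close> could be added to \<open>X\<close> without destroying
  separation, against maximality.\<close>

lemma maximal_separated_cover:
  fixes X :: "('a::euclidean_space \<times> real) set"
  assumes "maximal_separated \<epsilon> X" "0 < \<epsilon>" and y: "y \<in> sphere 0 1"
  obtains x where "x \<in> X" "y \<in> ball_pts (x, \<epsilon>)"
proof (cases "y \<in> X")
  case True
  then show ?thesis
    using that[of y] y \<open>0 < \<epsilon>\<close> by (simp add: ball_pts_def geodesic_dist_refl[OF DIM_prod_real_ge_2])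
next
  case False
  then have "\<not> separated \<epsilon> (insert y X)"
    using assms(1) unfolding maximal_separated_def by blast
  moreover have "separated \<epsilon> X"
    using assms(1) by (simp add: maximal_separated_def)
  moreover have "separated \<epsilon> (insert y X)"
    if "separated \<epsilon> X" "\<And>x. x \<in> X \<Longrightarrow> \<epsilon> \<le> geodesic_dist x y"
  proof -
    have "\<epsilon> \<le> geodesic_dist y x" if "x \<in> X" for x
      using \<open>\<And>x. x \<in> X \<Longrightarrow> \<epsilon> \<le> geodesic_dist x y\<close>[OF that] by (simp only: geodesic_dist_commute[of y x])
    with that y show ?thesis
      by (auto simp: separated_def)
  qed
  ultimately obtain x where "x \<in> X" "\<not> \<epsilon> \<le> geodesic_dist x y"
    by blast
  then show ?thesis
    using that[of x] y by (simp add: ball_pts_def)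
qed

text \<open>\<open>divide_ball\<close> quantifies existentially over the level; the radius leaves
  only one choice, since powers of 2 determine their exponents.\<close>

lemma level_subset_balls: "level J f k \<subseteq> balls J k"
proof (induction k)
  case (Suc k)
  have "B' \<in> balls J (Suc k)" if B: "B \<in> balls J k" and B': "B' \<in> divide_ball J B" for B B'
  proof -
    obtain i where i: "B \<in> balls J i" "B' \<in> balls J (Suc i)"
      using B' by (auto simp: divide_ball_def)
    with B have "(2::real) ^ i = 2 ^ k"
      by (auto simp: balls_def)
    then have "i = k"
      by (rule power_inject_exp[THEN iffD1, rotated]) simp
    with i show ?thesis
      by simp
  qed
  with Suc.IH show ?case
    by auto
qed simp

text \<open>The admissible exponents are at most the largest one, \<open>m\<close>. The full
  geometric sum up to \<open>m\<close> is below \<open>q ^ Suc m / (q - 1)\<close>, and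
  \<open>q ^ m \<le> X\<close>. The resulting bound does not depend on \<open>K\<close>.\<close>

lemma sum_powers_below_le:
  fixes q :: real
  assumes q: "1 < q" and X: "0 \<le> X"
  shows "(\<Sum>k | k < K \<and> q ^ k \<le> X. q ^ k) \<le> X * (q / (q - 1))"
proof (cases "{k. k < K \<and> q ^ k \<le> X} = {}")
  case True
  then show ?thesis
    using assms by (simp only: True) simp
next
  case False
  define m where "m = Max {k. k < K \<and> q ^ k \<le> X}"
  have fin: "finite {k. k < K \<and> q ^ k \<le> X}"
    by simp
  have m: "q ^ m \<le> X" "{k. k < K \<and> q ^ k \<le> X} \<subseteq> {..<Suc m}"
    using Max_in[OF fin False] Max_ge[OF fin] by (auto simp: m_def less_Suc_eq_le)
  have "(\<Sum>k | k < K \<and> q ^ k \<le> X. q ^ k) \<le> (\<Sum>k<Suc m. q ^ k)"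
    using m(2) q by (intro sum_mono2) auto
  also have "\<dots> = (q ^ Suc m - 1) / (q - 1)"
    using q by (subst geometric_sum) auto
  also have "\<dots> \<le> X * q / (q - 1)"
  proof (intro divide_right_mono)
    have "q * q ^ m \<le> q * X"
      using q m(1) by (intro mult_left_mono) auto
    then show "q ^ Suc m - 1 \<le> X * q"
      by (simp add: mult.commute)
  qed (use q in simp)
  finally show ?thesis by simp
qed

section \<open>Levels of the recursion: finiteness, extinction and covering\<close>

locale sphere_covering =
  fixes J :: "nat \<Rightarrow> ('a::euclidean_space \<times> real) set" and f :: "'a \<times> real \<Rightarrow> real" and A :: real
  assumes J: "\<And>k. maximal_separated (1 / 2 ^ k) (J k)"
    and A: "A \<ge> 0"
    and f_range: "f \<in> sphere 0 1 \<rightarrow> {0<..1}"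
    and f_lipschitz: "\<And>x y. x \<in> sphere 0 1 \<Longrightarrow> y \<in> sphere 0 1 \<Longrightarrow>
                        \<bar>f x - f y\<bar> \<le> A * geodesic_dist x y"
begin

sublocale finite_measure "sphere_measure :: ('a \<times> real) measure"
  by (rule finite_measure_sphere_measure)

lemma separated_J: "separated (1 / 2 ^ k) (J k)"
  using J[of k] by (simp add: maximal_separated_def)

lemma J_sphere: "x \<in> J k \<Longrightarrow> x \<in> sphere 0 1"
  using separated_J[of k] by (auto simp: separated_def)

lemma level_ball: "B \<in> level J f k \<Longrightarrow> fst B \<in> J k \<and> snd B = 1 / 2 ^ k"
  using level_subset_balls[of J f k] by (auto simp: balls_def)

lemma finite_level: "finite (level J f k)"
proof (rule finite_subset[OF level_subset_balls])
  have "balls J k = (\<lambda>x. (x, 1 / 2 ^ k)) ` J k"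
    by (auto simp: balls_def)
  then show "finite (balls J k)"
    using finite_separated[OF separated_J[of k]] by (simp add: power_le_one_iff)
qed

lemma f_continuous: "continuous_on (sphere 0 1) f"
  using DIM_prod_real_ge_2 f_lipschitz A by (rule continuous_on_lipschitz_geodesic)

lemma f_lower_bound: obtains m where "0 < m" "\<And>x. x \<in> sphere 0 1 \<Longrightarrow> m \<le> f x"
proof -
  have "sphere 0 1 \<noteq> ({} :: ('a \<times> real) set)"
    by simp
  then obtain x where x: "x \<in> sphere 0 1" "\<And>y. y \<in> sphere 0 1 \<Longrightarrow> f x \<le> f y"
    using continuous_attains_inf[OF compact_sphere _ f_continuous] by blast
  with f_range have "0 < f x"
    by auto
  with x(2) show ?thesis
    using that by blast
qed

text \<open>Once the radius drops below a positive lower bound of \<open>f\<close>, every ball of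
  the level is accepted, so nothing is passed on to the next one.\<close>

lemma level_eventually_empty: "\<exists>k. level J f k = {}"
proof -
  obtain m where m: "0 < m" "\<And>x. x \<in> sphere 0 1 \<Longrightarrow> m \<le> f x"
    using f_lower_bound by blast
  obtain k where "(1 / 2) ^ k < m"
    using real_arch_pow_inv[OF m(1), of "1 / 2"] by auto
  then have "snd B < f (fst B)" if "B \<in> level J f k" for B
    using level_ball[OF that] m(2)[OF J_sphere] by (fastforce simp: power_one_over)
  then have "level J f (Suc k) = {}"
    by force
  then show ?thesis ..
qed

text \<open>This is the invariant behind the cover: at an empty level only accepted balls remain. If
  \<open>y\<close> lies in a rejected ball, maximality gives a ball of the next level containing
  \<open>y\<close>; the two meet at \<open>y\<close> itself, so the new ball is one of the divided
  ones.\<close>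

lemma level_cover:
  assumes "y \<in> sphere 0 1"
  shows "(\<exists>i<k. \<exists>B\<in>level J f i. snd B < f (fst B) \<and> y \<in> ball_pts B) \<or>
    (\<exists>B\<in>level J f k. y \<in> ball_pts B)"
proof (induction k)
  case 0
  obtain x where x: "x \<in> J 0" "y \<in> ball_pts (x, 1 / 2 ^ 0)"
    using maximal_separated_cover[OF J[of 0] _ assms] by auto
  then have "(x, 1 / 2 ^ 0) \<in> level J f 0"
    unfolding level.simps balls_def by blast
  with x(2) show ?case
    by blast
next
  case (Suc k)
  have "?case" if B: "B \<in> level J f k" "y \<in> ball_pts B" for B
  proof (cases "snd B < f (fst B)")
    case False
    obtain x where x: "x \<in> J (Suc k)" "y \<in> ball_pts (x, 1 / 2 ^ Suc k)"
      using maximal_separated_cover[OF J[of "Suc k"] _ assms] by auto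
    have "B \<in> balls J k"
      using B(1) level_subset_balls by blast
    moreover have "(x, 1 / 2 ^ Suc k) \<in> balls J (Suc k)"
      unfolding balls_def using x(1) by blast
    ultimately have "(x, 1 / 2 ^ Suc k) \<in> divide_ball J B"
      unfolding divide_ball_def using x(2) B(2) by blast
    with False B(1) have "(x, 1 / 2 ^ Suc k) \<in> level J f (Suc k)"
      unfolding level.simps not_less by blast
    with x(2) show ?thesis
      by blast
  qed (use B in blast)
  with Suc.IH show ?case
    using less_SucI by blast
qed

section \<open>Pointwise estimates on the half balls\<close>

lemma f_le_on_half_ball:
  assumes B: "B \<in> level J f k" and y: "y \<in> ball_pts (fst B, 1 / 2 ^ k / 2)"
  shows "f y \<le> (2 + 7 / 2 * A) / 2 ^ k"
proof -
  have y': "y \<in> sphere 0 1" "geodesic_dist (fst B) y < 1 / 2 ^ k / 2"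
    using y by (auto simp: ball_pts_def)
  have c: "fst B \<in> sphere 0 1"
    using level_ball[OF B] J_sphere by blast
  show ?thesis
  proof (cases k)
    \<comment> \<open>Level 0 has no parent; there \<open>f \<le> 1\<close> is enough, because
      \<open>1 \<le> 2 + 7 / 2 * A\<close>.\<close>
    case 0
    have "f y \<le> 1"
      using f_range y' by auto
    then show ?thesis
      using A 0 by simp
  next
    case (Suc i)
    obtain B' where B': "B' \<in> level J f i" "f (fst B') \<le> snd B'" "B \<in> divide_ball J B'"
      using B by (auto simp: Suc)
    then obtain z where z: "z \<in> ball_pts B" "z \<in> ball_pts B'"
      by (auto simp: divide_ball_def)
    have c': "fst B' \<in> sphere 0 1"
      using level_ball[OF B'(1)] J_sphere by blast
    have r: "snd B = 1 / 2 ^ k" "snd B' = 2 / 2 ^ k"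
      using level_ball[OF B] level_ball[OF B'(1)] by (simp_all add: Suc)
    have z': "z \<in> sphere 0 1" "geodesic_dist z (fst B) < 1 / 2 ^ k" "geodesic_dist (fst B') z < 2 / 2 ^ k"
      using z r by (auto simp: ball_pts_def geodesic_dist_commute)
    \<comment> \<open>The route leads from the centre of the parent through a common point
      \<open>z\<close> of both balls and the centre of \<open>B\<close> to \<open>y\<close>. Its
      legs, less than 2, 1 and 1/2 times \<open>1 / 2 ^ k\<close>, add up to the constant
      7/2.\<close>
    have "geodesic_dist (fst B') y \<le> geodesic_dist (fst B') z + geodesic_dist z (fst B) + geodesic_dist (fst B) y"
      using geodesic_dist_triangle[OF DIM_prod_real_ge_2 c' c y'(1)]
        geodesic_dist_triangle[OF DIM_prod_real_ge_2 c' z'(1) c] by simp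
    also have "\<dots> \<le> 2 / 2 ^ k + 1 / 2 ^ k + 1 / 2 ^ k / 2"
      using z' y' by linarith
    also have "\<dots> = 7 / 2 / 2 ^ k"
      by simp
    finally have "A * geodesic_dist (fst B') y \<le> A * (7 / 2 / 2 ^ k)"
      using A by (rule mult_left_mono)
    moreover have "f y \<le> f (fst B') + A * geodesic_dist (fst B') y"
      using f_lipschitz[OF c' y'(1)] by simp
    ultimately have "f y \<le> 2 / 2 ^ k + A * (7 / 2 / 2 ^ k)"
      using B'(2) r by simp
    then show ?thesis
      by (simp add: add_divide_distrib mult.commute)
  qed
qed

text \<open>Half balls of one level are disjoint, so at most one term is nonzero; if there is one,
  \<open>f_le_on_half_ball\<close> yields the inequality tested on the right.\<close>

lemma sum_indicator_half_balls_le: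
  assumes y: "y \<in> sphere 0 1"
  shows "(\<Sum>B\<in>level J f k. indicator (ball_pts (fst B, 1 / 2 ^ k / 2)) y)
    \<le> (if 2 ^ k \<le> (2 + 7 / 2 * A) / f y then 1 else 0 :: real)"
proof (cases "\<exists>B\<in>level J f k. y \<in> ball_pts (fst B, 1 / 2 ^ k / 2)")
  case True
  then obtain B where B: "B \<in> level J f k" "y \<in> ball_pts (fst B, 1 / 2 ^ k / 2)"
    by blast
  have unique: "B' = B" if B': "B' \<in> level J f k" "y \<in> ball_pts (fst B', 1 / 2 ^ k / 2)" for B'
  proof -
    have "fst B' = fst B"
      using separated_disjoint_ball_pts[OF separated_J[of k]] level_ball[OF B(1)] level_ball[OF B'(1)]
        B(2) B'(2) unfolding disjoint_family_on_def by blast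
    then show ?thesis
      using level_ball[OF B(1)] level_ball[OF B'(1)] by (simp add: prod_eq_iff)
  qed
  have "(\<Sum>B'\<in>level J f k. indicator (ball_pts (fst B', 1 / 2 ^ k / 2)) y)
      = (\<Sum>B'\<in>level J f k. if B' = B then 1 else 0 :: real)"
  proof (intro sum.cong refl)
    show "indicator (ball_pts (fst B', 1 / 2 ^ k / 2)) y = (if B' = B then 1 else 0 :: real)"
      if "B' \<in> level J f k" for B'
      using unique[OF that] B(2) by (cases "B' = B") (auto simp: indicator_def)
  qed
  also have "\<dots> = 1"
    using B(1) finite_level by simp
  finally have "(\<Sum>B'\<in>level J f k. indicator (ball_pts (fst B', 1 / 2 ^ k / 2)) y) = (1 :: real)" .
  moreover have "2 ^ k \<le> (2 + 7 / 2 * A) / f y"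
    using f_le_on_half_ball[OF B] funcset_mem[OF f_range y]
    by (simp add: pos_le_divide_eq mult.commute)
  ultimately show ?thesis
    by simp
next
  case False
  then have "(\<Sum>B\<in>level J f k. indicator (ball_pts (fst B, 1 / 2 ^ k / 2)) y) = (0 :: real)"
    by (intro sum.neutral) auto
  then show ?thesis
    by simp
qed

text \<open>Raising the test \<open>2 ^ k \<le> X\<close> to the power \<open>n\<close> turns it
  into a condition on the weight \<open>(2 ^ n) ^ k\<close>, so \<open>sum_powers_below_le\<close>
  applies with base \<open>2 ^ n\<close>.\<close>

lemma weighted_sum_indicator_half_balls_le:
  assumes y: "y \<in> sphere 0 1"
  shows "(\<Sum>k<K. (2 ^ DIM('a)) ^ k * (\<Sum>B\<in>level J f k. indicator (ball_pts (fst B, 1 / 2 ^ k / 2)) y))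
    \<le> (2 + 7 / 2 * A) ^ DIM('a) * (2 ^ DIM('a) / (2 ^ DIM('a) - 1)) * (1 / f y) ^ DIM('a)"
proof -
  define n where "n = DIM('a)"
  define X where "X = (2 + 7 / 2 * A) / f y"
  have X: "0 \<le> X"
    using A funcset_mem[OF f_range y] by (simp add: X_def)
  have "n \<ge> 1"
    using DIM_positive[where 'a = 'a] by (simp add: n_def)
  then have q: "1 < (2::real) ^ n"
    by simp
  have iff: "2 ^ k \<le> X \<longleftrightarrow> (2 ^ n) ^ k \<le> X ^ n" for k
  proof -
    have "(2 ^ n) ^ k = ((2::real) ^ k) ^ n"
      by (simp only: power_mult[symmetric] mult.commute)
    then show ?thesis
      using power_mono_iff[of "2 ^ k" X n] X \<open>n \<ge> 1\<close> by simp
  qed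
  have "(\<Sum>k<K. (2 ^ n) ^ k * (\<Sum>B\<in>level J f k. indicator (ball_pts (fst B, 1 / 2 ^ k / 2)) y))
      \<le> (\<Sum>k<K. (2 ^ n) ^ k * (if 2 ^ k \<le> X then 1 else 0 :: real))"
    unfolding X_def by (intro sum_mono mult_left_mono sum_indicator_half_balls_le y) simp
  also have "\<dots> = (\<Sum>k | k < K \<and> (2 ^ n) ^ k \<le> X ^ n. (2 ^ n) ^ k)"
    by (intro sum.mono_neutral_cong_right) (auto simp: iff)
  also have "\<dots> \<le> X ^ n * (2 ^ n / (2 ^ n - 1))"
    using q X by (intro sum_powers_below_le) auto
  finally show ?thesis
    by (simp add: X_def n_def power_divide mult_ac)
qed

section \<open>Integration over the sphere and the final constant\<close>

lemma integrable_inverse_f_power: "integrable sphere_measure (\<lambda>x. (1 / f x) ^ N)"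
proof -
  obtain m where m: "0 < m" "\<And>x. x \<in> sphere 0 1 \<Longrightarrow> m \<le> f x"
    using f_lower_bound by blast
  have "(\<lambda>x. (1 / f x) ^ N) \<in> borel_measurable (restrict_space borel (sphere 0 1))"
    by (intro borel_measurable_continuous_on_restrict continuous_intros f_continuous)
      (use m in force)
  then have "(\<lambda>x. (1 / f x) ^ N) \<in> borel_measurable sphere_measure"
    by (simp add: measurable_cong_sets[OF sets_sphere_measure])
  moreover have "AE x in sphere_measure. norm ((1 / f x) ^ N) \<le> (1 / m) ^ N"
  proof (rule AE_I2)
    fix x :: "'a \<times> real" assume "x \<in> space sphere_measure"
    then have "m \<le> f x"
      using m(2) by (simp add: space_sphere_measure)
    with m(1) show "norm ((1 / f x) ^ N) \<le> (1 / m) ^ N"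
      by (auto simp: norm_power intro!: power_mono divide_left_mono)
  qed
  ultimately show ?thesis
    by (rule integrable_const_bound[rotated])
qed

text \<open>Since \<open>f \<le> 1\<close>, the integrand is at least 1 on a sphere of positive
  volume. The strictness of the final bound rests on this positivity.\<close>

lemma integral_inverse_f_power_pos: "0 < (LINT x|sphere_measure. (1 / f x) ^ N)"
proof -
  have "emeasure sphere_measure (sphere (0 :: 'a \<times> real) 1) = ennreal (measure sphere_measure (sphere (0 :: 'a \<times> real) 1))"
    by (rule emeasure_eq_measure)
  moreover have "0 < emeasure sphere_measure (sphere (0 :: 'a \<times> real) 1)"
    by (simp only: emeasure_sphere_measure_sphere) simp
  ultimately have "0 < measure sphere_measure (sphere (0 :: 'a \<times> real) 1)"
    by simp
  also have "\<dots> = (LINT x|(sphere_measure :: ('a \<times> real) measure). 1 :: real)"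
    by (simp flip: space_sphere_measure)
  also have "\<dots> \<le> (LINT x|sphere_measure. (1 / f x) ^ N)"
  proof (intro integral_mono integrable_inverse_f_power one_le_power)
    fix x :: "'a \<times> real" assume "x \<in> space sphere_measure"
    then have "0 < f x \<and> f x \<le> 1"
      using funcset_mem[OF f_range, of x] by (simp add: space_sphere_measure)
    then show "1 \<le> 1 / f x"
      by simp
  qed simp
  finally show ?thesis .
qed

lemma sum_card_level_le:
  "(\<Sum>k<K. real (card (level J f k))) * ((7 / 8) ^ (DIM('a) + 1) * unit_ball_vol DIM('a) / 2 ^ DIM('a))
    \<le> (2 + 7 / 2 * A) ^ DIM('a) * (2 ^ DIM('a) / (2 ^ DIM('a) - 1))
       * (LINT x|sphere_measure. (1 / f x) ^ DIM('a))"
proof -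
  let ?n = "DIM('a)"
  let ?g = "\<lambda>y. \<Sum>k<K. (2 ^ ?n) ^ k * (\<Sum>B\<in>level J f k. indicator (ball_pts (fst B, 1 / 2 ^ k / 2)) y) :: real"
  have sph: "fst B \<in> sphere 0 1" if "B \<in> level J f k" for B k
    using level_ball[OF that] J_sphere by blast
  then have sets: "ball_pts (fst B, 1 / 2 ^ k / 2) \<in> sets sphere_measure" if "B \<in> level J f k" for B k
    using that by (intro sets_ball_pts) auto
  have ind: "integrable sphere_measure (indicator (ball_pts (fst B, 1 / 2 ^ k / 2)) :: _ \<Rightarrow> real)"
    if "B \<in> level J f k" for B k
    using sets[OF that] by (simp add: emeasure_eq_measure)
  then have int: "integrable sphere_measure ?g"
    by (intro Bochner_Integration.integrable_sum integrable_mult_right) auto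
  \<comment> \<open>The weight cancels the power of \<open>1 / 2 ^ k\<close> in the volume bound, so
    every ball counts equally, whatever its level.\<close>
  have "(\<Sum>k<K. real (card (level J f k))) * ((7 / 8) ^ (?n + 1) * unit_ball_vol ?n / 2 ^ ?n)
      = (\<Sum>k<K. (2 ^ ?n) ^ k * (\<Sum>B\<in>level J f k. (7 / 8) ^ (?n + 1) * (unit_ball_vol ?n * (1 / 2 ^ k / 2) ^ ?n)))"
    unfolding sum_distrib_right
  proof (intro sum.cong refl)
    fix k
    have eq: "(2 ^ ?n) ^ k = ((2::real) ^ k) ^ ?n"
      by (simp only: power_mult[symmetric] mult.commute)
    have "(1 / 2 ^ k / 2 :: real) ^ ?n = 1 / ((2 ^ k) ^ ?n * 2 ^ ?n)"
      by (simp only: power_divide power_one divide_divide_eq_left power_mult_distrib)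
    then show "real (card (level J f k)) * ((7 / 8) ^ (?n + 1) * unit_ball_vol ?n / 2 ^ ?n)
      = (2 ^ ?n) ^ k * (\<Sum>B\<in>level J f k. (7 / 8) ^ (?n + 1) * (unit_ball_vol ?n * (1 / 2 ^ k / 2) ^ ?n))"
      unfolding eq by simp
  qed
  also have "\<dots> \<le> (\<Sum>k<K. (2 ^ ?n) ^ k * (\<Sum>B\<in>level J f k. measure sphere_measure (ball_pts (fst B, 1 / 2 ^ k / 2))))"
    using sph by (intro sum_mono mult_left_mono measure_ball_pts_ge) auto
  also have "\<dots> = (LINT y|sphere_measure. ?g y)"
    using ind sets by (simp add: Bochner_Integration.integral_sum)
  also have "\<dots> \<le> (LINT y|sphere_measure.
      (2 + 7 / 2 * A) ^ ?n * (2 ^ ?n / (2 ^ ?n - 1)) * (1 / f y) ^ ?n)"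
  proof (rule integral_mono[OF int])
    show "integrable sphere_measure (\<lambda>y. (2 + 7 / 2 * A) ^ ?n * (2 ^ ?n / (2 ^ ?n - 1)) * (1 / f y) ^ ?n)"
      by (intro integrable_mult_right integrable_inverse_f_power)
    show "?g y \<le> (2 + 7 / 2 * A) ^ ?n * (2 ^ ?n / (2 ^ ?n - 1)) * (1 / f y) ^ ?n"
      if "y \<in> space sphere_measure" for y
      using that by (intro weighted_sum_indicator_half_balls_le) (simp add: space_sphere_measure)
  qed
  also have "\<dots> = (2 + 7 / 2 * A) ^ ?n * (2 ^ ?n / (2 ^ ?n - 1))
       * (LINT x|sphere_measure. (1 / f x) ^ ?n)"
    by (rule integral_mult_right_zero)
  finally show ?thesis .
qed

lemma sum_card_level_less:
  "(\<Sum>k<K. real (card (level J f k))) <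
     (16 * (2 + A)) ^ DIM('a) / (measure sphere_measure (sphere (0::'a) 1) * ln 2) *
     (LINT x|sphere_measure. (1 / f x) ^ DIM('a))"
proof -
  define n where "n = DIM('a)"
  define I where "I = (LINT x|sphere_measure. (1 / f x) ^ n)"
  define v where "v = unit_ball_vol n"
  define Q :: real where "Q = 2 ^ n - 1"
  define N where "N = (\<Sum>k<K. real (card (level J f k)))"
  have n: "n \<ge> 1"
    using DIM_positive[where 'a = 'a] by (simp add: n_def)
  have pos: "0 < v" "0 < I"
    using integral_inverse_f_power_pos by (auto simp: v_def I_def)
  \<comment> \<open>This is A_n: the (n-1)-dimensional unit sphere is the one in \<open>'a\<close>,
    not the one in \<open>'a \<times> real\<close>.\<close>
  have "measure sphere_measure (sphere (0::'a) 1) = n * v"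
    using emeasure_sphere_measure_sphere[where 'b = 'a] by (simp add: measure_def n_def v_def)
  have q: "real n \<le> 2 ^ n - 1"
  proof -
    have "n + 1 \<le> 2 ^ n"
      by (simp add: Suc_leI)
    then have "real (n + 1) \<le> real (2 ^ n)"
      by (simp only: of_nat_le_iff)
    then show ?thesis by simp
  qed
  \<comment> \<open>Inserting this factor 1 and cancelling \<open>v\<close> and \<open>2 ^ n\<close>
    makes the left-hand side of \<open>sum_card_level_le\<close> appear.\<close>
  have "(8 / 7) ^ (n + 1) * (7 / 8 :: real) ^ (n + 1) = 1"
    unfolding power_mult_distrib[symmetric] by simp
  moreover have "N = (a * c) * N \<Longrightarrow> N = a * 2 ^ n / v * (N * (c * v / 2 ^ n))" for a c :: real
    using pos(1) by simp
  ultimately have "N = (8 / 7) ^ (n + 1) * 2 ^ n / v * (N * ((7 / 8) ^ (n + 1) * v / 2 ^ n))"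
    by (metis mult_1)
  also have "\<dots> \<le> (8 / 7) ^ (n + 1) * 2 ^ n / v * ((2 + 7 / 2 * A) ^ n * (2 ^ n / (2 ^ n - 1)) * I)"
    using sum_card_level_le[of K] pos
    by (intro mult_left_mono) (auto simp: N_def I_def v_def n_def)
  \<comment> \<open>The factor \<open>32 / 7\<close> is \<open>8 / 7 * 2 * 2\<close>, collected
    under the power \<open>n\<close>; one \<open>8 / 7\<close> is left over from the exponent
    \<open>n + 1\<close>.\<close>
  also have "\<dots> = (32 / 7 * (2 + 7 / 2 * A)) ^ n * I / v * (8 / 7 / (2 ^ n - 1))"
  proof -
    have p: "(32 / 7 * (2 + 7 / 2 * A)) ^ n = (8 / 7) ^ n * 2 ^ n * 2 ^ n * (2 + 7 / 2 * A) ^ n"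
      unfolding power_mult_distrib[symmetric] by simp
    show ?thesis
      unfolding p Q_def[symmetric] by (simp add: mult_ac)
  qed
  \<comment> \<open>The base on the left is \<open>64 / 7 + 16 * A\<close>, and
    \<open>64 / 7 \<le> 32\<close>.\<close>
  also have "\<dots> \<le> (16 * (2 + A)) ^ n * I / v * (8 / 7 / (2 ^ n - 1))"
    using A pos n by (intro mult_right_mono divide_right_mono power_mono) auto
  \<comment> \<open>The strict inequality comes from \<open>8 / 7 * ln 2 < 1\<close> and
    \<open>n \<le> 2 ^ n - 1\<close>, the factor in front being positive; \<open>n\<close> then
    joins \<open>v\<close> to form A_n.\<close>
  also have "\<dots> < (16 * (2 + A)) ^ n * I / v * (1 / (n * ln 2))"
  proof (rule mult_strict_left_mono)
    have "ln 2 * 8 / 7 < (1::real)"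
      using ln2_le_25_over_36 by simp
    then have "8 / 7 * (n * ln 2) < real n"
      using n mult_strict_left_mono[of "ln 2 * 8 / 7" 1 "real n"] by simp
    also note q
    finally have "8 / 7 * (n * ln 2) < Q"
      by (simp only: Q_def)
    moreover have "0 < n * ln 2" "0 < Q"
      using n q by (auto simp: Q_def)
    ultimately show "8 / 7 / (2 ^ n - 1) < 1 / (n * ln 2)"
      unfolding Q_def[symmetric] by (simp add: divide_less_eq less_divide_eq mult.commute)
    show "0 < (16 * (2 + A)) ^ n * I / v"
      using pos A by simp
  qed
  finally show ?thesis
    unfolding n_def[symmetric] \<open>measure _ _ = n * v\<close> N_def[symmetric] I_def[symmetric]
    by (simp add: mult.commute mult.left_commute)
qed

end

section \<open>Executions of the algorithm\<close>

text \<open>\<open>Bs\<close> enters only through its set and its length, so the order of the inner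
  loop does not influence the outcome.\<close>

lemma fold_process_ball:
  "fold (process_ball J f) Bs (F, N, m) =
     (F \<union> {B \<in> set Bs. snd B < f (fst B)},
      N \<union> \<Union> {divide_ball J B | B. B \<in> set Bs \<and> snd B \<ge> f (fst B)}, m + length Bs)"
proof (induction Bs arbitrary: F N m)
  case (Cons B Bs)
  obtain x r where B: "B = (x, r)"
    by (cases B)
  show ?case
  proof (cases "r < f x")
    case True
    then show ?thesis
      by (auto simp: B Cons.IH)
  next
    case False
    then have "\<Union> {divide_ball J B' | B'. B' \<in> set (B # Bs) \<and> snd B' \<ge> f (fst B')}
       = divide_ball J B \<union> \<Union> {divide_ball J B' | B'. B' \<in> set Bs \<and> snd B' \<ge> f (fst B')}"
      by (fastforce simp: B)
    with False show ?thesis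
      by (auto simp: B Cons.IH)
  qed
qed auto

text \<open>From a level the step is deterministic, so executions run through the levels in order.
  Finiteness appears because only a finite level has an enumeration \<open>Bs\<close>.\<close>

lemma algo_step_level_iff:
  "algo_step J f (level J f k, F, m) s \<longleftrightarrow> level J f k \<noteq> {} \<and> finite (level J f k) \<and>
     s = (level J f (Suc k), F \<union> {B \<in> level J f k. snd B < f (fst B)}, m + card (level J f k))"
proof
  assume "algo_step J f (level J f k, F, m) s"
  then show "level J f k \<noteq> {} \<and> finite (level J f k) \<and>
     s = (level J f (Suc k), F \<union> {B \<in> level J f k. snd B < f (fst B)}, m + card (level J f k))"
  proof (cases rule: algo_step.cases)
    case (1 Bs)
    then have "finite (level J f k)" "length Bs = card (level J f k)"
      using distinct_card[of Bs] List.finite_set[of Bs] by simp_all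
    with 1 show ?thesis
      by (simp add: fold_process_ball)
  qed
next
  assume *: "level J f k \<noteq> {} \<and> finite (level J f k) \<and>
     s = (level J f (Suc k), F \<union> {B \<in> level J f k. snd B < f (fst B)}, m + card (level J f k))"
  then obtain Bs where "set Bs = level J f k" "distinct Bs"
    using finite_distinct_list by blast
  with * distinct_card[of Bs] show "algo_step J f (level J f k, F, m) s"
    by (auto intro!: algo_step.intros[where Bs = Bs] simp: fold_process_ball)
qed

text \<open>Here \<open>k\<close> counts the completed passes. Non-emptiness of the earlier levels
  is recorded in order to identify \<open>k\<close> as the least empty level when the execution
  stops.\<close>

lemma algo_reachable:
  assumes "(algo_step J f)\<^sup>*\<^sup>* (algo_init J) s"
  obtains k where "s = (level J f k, \<Union>i<k. {B \<in> level J f i. snd B < f (fst B)}, \<Sum>i<k. card (level J f i))"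
    "\<forall>i<k. level J f i \<noteq> {}"
proof -
  have "\<exists>k. s = (level J f k, \<Union>i<k. {B \<in> level J f i. snd B < f (fst B)}, \<Sum>i<k. card (level J f i))
      \<and> (\<forall>i<k. level J f i \<noteq> {})"
    using assms
  proof (induction rule: rtranclp_induct)
    case base
    show ?case
      by (rule exI[of _ 0]) (simp add: algo_init_def)
  next
    case (step s t)
    then obtain k where
      s: "s = (level J f k, \<Union>i<k. {B \<in> level J f i. snd B < f (fst B)}, \<Sum>i<k. card (level J f i))"
      and "\<forall>i<k. level J f i \<noteq> {}"
      by blast
    with step.hyps(2) show ?case
      unfolding s algo_step_level_iff
      by (intro exI[of _ "Suc k"]) (auto simp: less_Suc_eq lessThan_Suc)
  qed
  then show ?thesis
    using that by blast
qed

text \<open>Downward induction from \<open>K\<close>: the empty level has no successor, and any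
  other level leads at most to the next one. \<open>F\<close> and \<open>m\<close> are arbitrary
  because every step changes them.\<close>

lemma termip_algo_step:
  assumes "level J f K = {}"
  shows "termip (algo_step J f) (algo_init J)"
proof -
  have "termip (algo_step J f) (level J f i, F, m)" if "i \<le> K" for i F m
    using that
  proof (induction i arbitrary: F m rule: inc_induct)
    case base
    show ?case
    proof (rule accp.intros)
      fix s assume "(algo_step J f)\<inverse>\<inverse> s (level J f K, F, m)"
      then have "level J f K \<noteq> {}"
        unfolding conversep_iff algo_step_level_iff by blast
      with assms show "termip (algo_step J f) s"
        by blast
    qed
  next
    case (step i)
    show ?case
    proof (rule accp.intros)
      fix s assume "(algo_step J f)\<inverse>\<inverse> s (level J f i, F, m)"
      then have "s = (level J f (Suc i), F \<union> {B \<in> level J f i. snd B < f (fst B)}, m + card (level J f i))"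
        unfolding conversep_iff algo_step_level_iff by blast
      then show "termip (algo_step J f) s"
        by (simp only: step.IH)
    qed
  qed
  from this[of 0 "{}" 0] show ?thesis
    by (simp add: algo_init_def)
qed

lemma algo_terminatesI:
  assumes "level J f K = {}" "\<And>k. finite (level J f k)"
  shows "algo_terminates J f"
  unfolding algo_terminates_def
proof (intro conjI allI impI)
  show "termip (algo_step J f) (algo_init J)"
    using assms(1) by (rule termip_algo_step)
  fix T F m
  assume "(algo_step J f)\<^sup>*\<^sup>* (algo_init J) (T, F, m) \<and> T \<noteq> {}"
  then have "(algo_step J f)\<^sup>*\<^sup>* (algo_init J) (T, F, m)" "T \<noteq> {}"
    by blast+
  then obtain k where "T = level J f k"
    by (auto elim: algo_reachable)
  with \<open>T \<noteq> {}\<close> show "\<exists>s. algo_step J f (T, F, m) s"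
    using assms(2) by (auto simp: algo_step_level_iff)
qed

lemma algo_returnsD:
  assumes "algo_returns J f F m"
  defines "k \<equiv> LEAST k. level J f k = {}"
  shows "\<exists>k. level J f k = {}" "F = accepted J f k" "m = (\<Sum>i<k. card (level J f i))"
proof -
  obtain i where i: "level J f i = {}" "\<forall>j<i. level J f j \<noteq> {}"
    and F: "F = (\<Union>j<i. {B \<in> level J f j. snd B < f (fst B)})" and m: "m = (\<Sum>j<i. card (level J f j))"
    using assms(1) unfolding algo_returns_def by (auto elim!: algo_reachable)
  show "\<exists>k. level J f k = {}"
    using i by blast
  have k: "k = i"
    unfolding k_def using i by (intro Least_equality) (auto simp: not_less[symmetric])
  show "m = (\<Sum>i<k. card (level J f i))"
    by (simp add: k m)
  \<comment> \<open>\<open>accepted\<close> includes the index \<open>i\<close>, whereas only the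
    passes before \<open>i\<close> were run; the unions agree because level \<open>i\<close> is
    empty.\<close>
  have "{0..i} = insert i {..<i}"
    by auto
  then show "F = accepted J f k"
    using i(1) by (simp add: k F accepted_def)
qed

text \<open>The n-dimensional sphere sits in \<open>'a \<times> real\<close>, while the unit sphere
  of \<open>'a\<close> contributes A_n. The claims cover all executions, hence all orders of the
  inner loops, and \<open>algo_terminates\<close> excludes that none of them returns.\<close>

theorem theorem2p5:
  fixes n :: nat and A :: real
    and J :: "nat \<Rightarrow> ('a::euclidean_space \<times> real) set"
    and f :: "'a \<times> real \<Rightarrow> real"
  assumes dim: "DIM('a) = n" and n: "n \<ge> 1"
    and J: "\<And>k. maximal_separated (1 / 2 ^ k) (J k)"
    and A: "A \<ge> 0"
    and f_range: "f \<in> sphere 0 1 \<rightarrow> {0<..1}"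
    and f_lipschitz: "\<And>x y. x \<in> sphere 0 1 \<Longrightarrow> y \<in> sphere 0 1 \<Longrightarrow>
                        \<bar>f x - f y\<bar> \<le> A * geodesic_dist x y"
  shows "algo_terminates J f \<and>
    (\<forall>L_final evals. algo_returns J f L_final evals \<longrightarrow>
       finite L_final \<and>
       (\<forall>B\<in>L_final. fst B \<in> sphere 0 1 \<and> 0 < snd B \<and>
          openin (top_of_set (sphere 0 1)) (ball_pts B) \<and> snd B \<le> f (fst B)) \<and>
       (\<Union>B\<in>L_final. ball_pts B) = sphere 0 1 \<and>
       real evals <
         (16 * (2 + A)) ^ n / (measure sphere_measure (sphere (0::'a) 1) * ln 2) *
         (LINT x|sphere_measure. (1 / f x) ^ n) \<and>
       (\<exists>k. level J f k = {}) \<and>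
       L_final = accepted J f (LEAST k. level J f k = {}))"
proof -
  interpret sphere_covering J f A
    using J A f_range f_lipschitz by unfold_locales
  have "algo_terminates J f"
    using level_eventually_empty finite_level by (blast intro: algo_terminatesI)
  moreover have "finite L \<and>
       (\<forall>B\<in>L. fst B \<in> sphere 0 1 \<and> 0 < snd B \<and>
          openin (top_of_set (sphere 0 1)) (ball_pts B) \<and> snd B \<le> f (fst B)) \<and>
       (\<Union>B\<in>L. ball_pts B) = sphere 0 1 \<and>
       real evals <
         (16 * (2 + A)) ^ n / (measure sphere_measure (sphere (0::'a) 1) * ln 2) *
         (LINT x|sphere_measure. (1 / f x) ^ n) \<and>
       (\<exists>k. level J f k = {}) \<and>
       L = accepted J f (LEAST k. level J f k = {})"
    if "algo_returns J f L evals" for L evals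
  proof (intro conjI)
    define k where "k = (LEAST k. level J f k = {})"
    note L = algo_returnsD[OF that, folded k_def]
    have empty: "level J f k = {}"
      unfolding k_def using level_eventually_empty by (rule LeastI_ex)
    show "\<exists>k. level J f k = {}" "L = accepted J f (LEAST k. level J f k = {})"
      using L by (simp_all add: k_def)
    show "finite L"
      unfolding L(2) accepted_def using finite_level by auto
    show "\<forall>B\<in>L. fst B \<in> sphere 0 1 \<and> 0 < snd B \<and>
          openin (top_of_set (sphere 0 1)) (ball_pts B) \<and> snd B \<le> f (fst B)"
    proof
      fix B assume "B \<in> L"
      then obtain i where B: "B \<in> level J f i" "snd B < f (fst B)"
        unfolding L(2) accepted_def by blast
      have "fst B \<in> sphere 0 1" "0 < snd B"
        using level_ball[OF B(1)] J_sphere[of "fst B" i] by auto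
      with B(2) show "fst B \<in> sphere 0 1 \<and> 0 < snd B \<and>
          openin (top_of_set (sphere 0 1)) (ball_pts B) \<and> snd B \<le> f (fst B)"
        using openin_ball_pts[OF DIM_prod_real_ge_2] by (simp only: less_imp_le simp_thms)
    qed
    \<comment> \<open>Level \<open>k\<close> is empty, so \<open>level_cover\<close> leaves only the
      alternative of an accepted ball of an earlier level.\<close>
    have "y \<in> (\<Union>B\<in>L. ball_pts B)" if y: "y \<in> sphere 0 1" for y
    proof -
      obtain i B where "i < k" "B \<in> level J f i" "snd B < f (fst B)" "y \<in> ball_pts B"
        using level_cover[OF y, of k] empty by blast
      then show ?thesis
        unfolding L(2) accepted_def by fastforce
    qed
    moreover have "ball_pts B \<subseteq> sphere 0 1" for B :: "('a \<times> real) gball"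
      unfolding ball_pts_def by blast
    ultimately show "(\<Union>B\<in>L. ball_pts B) = sphere 0 1"
      by blast
    show "real evals <
         (16 * (2 + A)) ^ n / (measure sphere_measure (sphere (0::'a) 1) * ln 2) *
         (LINT x|sphere_measure. (1 / f x) ^ n)"
      using sum_card_level_less[of k] unfolding L(3) of_nat_sum dim .
  qed
  ultimately show ?thesis
    by blast
qed

end
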